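(* For each $a\in\mathcal{A}$ let $R_{11}(a)=\mathbb{E}^{\pi_b}[x^{\mathrm{o}}(x^{\mathrm{o}})^T\mid a]$ and $R_{12}(a)=\mathbb{E}^{\pi_b}[x^{\mathrm{o}}(x^{\mathrm{h}})^T\mid a]$. Assume $P^{\pi_b}(a)>0$ and that $R_{11}(a)$ is invertible for all $a\in\mathcal{A}$. Let $$b^{LS}_a=\Big(\frac1{N_a}\sum_{i\le N:\,a_i=a}x_i^{\mathrm{o}}(x_i^{\mathrm{o}})^T\Big)^{-1}\Big(\frac1{N_a}\sum_{i\le N:\,a_i=a}x_i^{\mathrm{o}}r_i\Big),\qquad N_a=\sum_{i=1}^N\mathbf 1\{a_i=a\},$$ be the least-squares estimator computed from the first $N$ samples of the partially observable dataset. Then, almost surely, for all $a\in\mathcal{A}$, $$\lim_{N\to\infty}b_a^{LS}=\big(I_L,\;R_{11}^{-1}(a)R_{12}(a)\big)\,w_a^*.$$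
   Context: Let $1\le L<d$ and let $\mathcal{A}=\{1,\dots,K\}$ be a finite action set. A vector $x\in\mathbb{R}^d$ is written $x=((x^{\mathrm{o}})^T,(x^{\mathrm{h}})^T)^T$, where $x^{\mathrm{o}}\in\mathbb{R}^L$ (observed part) consists of the first $L$ coordinates and $x^{\mathrm{h}}\in\mathbb{R}^{d-L}$ (hidden part) of the remaining ones. The vectors $w_a^*\in\mathbb{R}^d$, $a\in\mathcal{A}$, are fixed. The data are generated as follows: $x_1,x_2,\dots$ are i.i.d. from a distribution $\mathcal{P}_x$ on $\mathbb{R}^d$; the action $a_i$ is drawn from $\pi_b(\cdot\mid x_i)$, where the behavior policy $\pi_b$ is a fixed map from contexts to probability distributions on $\mathcal{A}$ (so the pairs $(x_i,a_i)$ are i.i.d.); and $r_i=\langle x_i,w^*_{a_i}\rangle+\eta_i$, where the noise $\eta_i$ is conditionally $\sigma$-subgaussian: $\mathbb{E}[e^{\lambda\eta_i}\mid F_{i-1}]\le e^{\lambda^2\sigma^2/2}$ for all $\lambda\in\mathbb{R}$, with $F_{i-1}=\sigma((x_1,a_1,\eta_1),\dots,(x_{i-1},a_{i-1},\eta_{i-1}),x_i,a_i)$. The dataset consists of $(x_i^{\mathrm{o}},a_i,r_i)_{i=1}^N$. $P^{\pi_b}$ and $\mathbb{E}^{\pi_b}$ denote probability and expectation for $x\sim\mathcal{P}_x$, $a\sim\pi_b(\cdot\mid x)$; $P^{\pi_b}(a)$ is the marginal probability of action $a$, and $\mathbb{E}^{\pi_b}[\cdot\mid a]$ is expectation conditional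 on the chosen action being $a$. $I_L$ is the $L\times L$ identity matrix. *)

theory Defs
  imports "HOL-Probability.Probability"
begin

text \<open>
  Contexts are vectors indexed by the disjoint sum of \<^typ>\<open>'l\<close> and \<^typ>\<open>'h\<close>, where
  L is the cardinality of \<^typ>\<open>'l\<close> and d - L that of \<^typ>\<open>'h\<close>; since types are nonempty,
  1 \<le> L < d holds automatically.
\<close>

definition obs :: "real ^ ('l :: finite + 'h :: finite) \<Rightarrow> real ^ 'l" where
  "obs x = (\<chi> i. x $ Inl i)"

definition hid :: "real ^ ('l :: finite + 'h :: finite) \<Rightarrow> real ^ 'h" where
  "hid x = (\<chi> j. x $ Inr j)"

definition outer :: "real ^ 'm \<Rightarrow> real ^ 'n \<Rightarrow> real ^ 'n ^ 'm" where
  "outer u v = (\<chi> i j. u $ i * v $ j)"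

definition block_row :: "real ^ ('l :: finite) ^ 'm \<Rightarrow> real ^ ('h :: finite) ^ 'm \<Rightarrow> real ^ ('l + 'h) ^ 'm" where
  "block_row A B = (\<chi> i k. case k of Inl j \<Rightarrow> A $ i $ j | Inr j \<Rightarrow> B $ i $ j)"

text \<open>
  The law of (x, a) when x is drawn from \<open>Px\<close> and then a from \<open>\<pi> x\<close>: its density with
  respect to the product of \<open>Px\<close> and counting measure on the actions 1, ..., K is
  \<open>pmf (\<pi> x) a\<close>.
\<close>

definition behavior_law ::
    "('v :: euclidean_space) measure \<Rightarrow> ('v \<Rightarrow> nat pmf) \<Rightarrow> nat \<Rightarrow> ('v \<times> nat) measure" where
  "behavior_law Px \<pi> K =
     density (Px \<Otimes>\<^sub>M count_space {1..K}) (\<lambda>(x, a). ennreal (pmf (\<pi> x) a))"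

lemma emeasure_behavior_law:
  assumes "prob_space Px" "sets Px = sets borel"
    and [measurable]: "\<And>a. (\<lambda>v. pmf (\<pi> v) a) \<in> borel_measurable borel"
    and B: "B \<in> sets borel" and a: "a \<in> {1..K}"
  shows "emeasure (behavior_law Px \<pi> K) (B \<times> {a}) = (\<integral>\<^sup>+v\<in>B. ennreal (pmf (\<pi> v) a) \<partial>Px)"
proof -
  interpret prob_space Px by fact
  interpret C: finite_measure "count_space {1..K}" by (rule finite_measure_count_space) simp
  interpret pair_sigma_finite Px "count_space {1..K}" ..
  have [measurable_cong]: "sets Px = sets borel" by fact
  have m: "(\<lambda>z. ennreal (pmf (\<pi> (fst z)) (snd z)))
      \<in> borel_measurable (Px \<Otimes>\<^sub>M count_space {1..K})"
    by (rule measurable_compose_countable'[where I = "{1..K}" and g = snd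
          and f = "\<lambda>a z. ennreal (pmf (\<pi> (fst z)) a)"]) simp_all
  have BA: "B \<times> {a} \<in> sets (Px \<Otimes>\<^sub>M count_space {1..K})"
    using assms by (intro pair_measureI) auto
  have "emeasure (behavior_law Px \<pi> K) (B \<times> {a}) =
      (\<integral>\<^sup>+z. ennreal (pmf (\<pi> (fst z)) (snd z)) * indicator (B \<times> {a}) z
         \<partial>(Px \<Otimes>\<^sub>M count_space {1..K}))"
    unfolding behavior_law_def case_prod_beta by (rule emeasure_density[OF m BA])
  also have "\<dots> = (\<integral>\<^sup>+v. (\<integral>\<^sup>+c. ennreal (pmf (\<pi> v) c) * indicator (B \<times> {a}) (v, c)
         \<partial>count_space {1..K}) \<partial>Px)"
    using C.nn_integral_fst[OF borel_measurable_times_ennreal[OF m borel_measurable_indicator[OF BA]]]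
    by simp
  also have "\<dots> = (\<integral>\<^sup>+v\<in>B. ennreal (pmf (\<pi> v) a) \<partial>Px)"
  proof (rule nn_integral_cong)
    fix v
    have "(\<integral>\<^sup>+c. ennreal (pmf (\<pi> v) c) * indicator (B \<times> {a}) (v, c) \<partial>count_space {1..K})
        = (\<Sum>c\<in>{1..K}. ennreal (pmf (\<pi> v) c) * indicator (B \<times> {a}) (v, c))"
      by (simp add: nn_integral_count_space_finite)
    also have "\<dots> = (\<Sum>c\<in>{1..K}. if c = a then ennreal (pmf (\<pi> v) a) * indicator B v else 0)"
      by (intro sum.cong) (auto simp: indicator_def)
    also have "\<dots> = ennreal (pmf (\<pi> v) a) * indicator B v"
      using a by simp
    finally show "(\<integral>\<^sup>+c. ennreal (pmf (\<pi> v) c) * indicator (B \<times> {a}) (v, c) \<partial>count_space {1..K})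
        = ennreal (pmf (\<pi> v) a) * indicator B v" .
  qed
  finally show ?thesis .
qed

definition action_prob :: "('v \<times> nat) measure \<Rightarrow> nat \<Rightarrow> real" where
  "action_prob P a = measure P {z \<in> space P. snd z = a}"

text \<open>The probability measure \<open>P\<close> conditioned on the chosen action being \<open>a\<close>.\<close>

definition given_action :: "('v \<times> nat) measure \<Rightarrow> nat \<Rightarrow> ('v \<times> nat) measure" where
  "given_action P a = uniform_measure P {z \<in> space P. snd z = a}"

definition R11 :: "((real ^ ('l :: finite + 'h :: finite)) \<times> nat) measure \<Rightarrow> nat \<Rightarrow> real ^ 'l ^ 'l" where
  "R11 P a = (\<integral>z. outer (obs (fst z)) (obs (fst z)) \<partial>given_action P a)"

definition R12 :: "((real ^ ('l :: finite + 'h :: finite)) \<times> nat) measure \<Rightarrow> nat \<Rightarrow> real ^ 'h ^ 'l" where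
  "R12 P a = (\<integral>z. outer (obs (fst z)) (hid (fst z)) \<partial>given_action P a)"

text \<open>
  The \<sigma>-algebra \<open>F\<^sub>i\<^sub>-\<^sub>1\<close> generated by the triples \<open>(x\<^sub>j, a\<^sub>j, \<eta>\<^sub>j)\<close>, 1 \<le> j < i, together with
  the current \<open>(x\<^sub>i, a\<^sub>i)\<close>, as a measure space on the underlying sample space.
\<close>

definition history ::
    "'w measure \<Rightarrow> nat \<Rightarrow> (nat \<Rightarrow> 'w \<Rightarrow> ('v :: euclidean_space)) \<Rightarrow> (nat \<Rightarrow> 'w \<Rightarrow> nat) \<Rightarrow>
      (nat \<Rightarrow> 'w \<Rightarrow> real) \<Rightarrow> nat \<Rightarrow> 'w measure" where
  "history M K x act \<eta> i =
     vimage_algebra (space M)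
       (\<lambda>\<omega>. (\<lambda>j\<in>{1..<i}. (x j \<omega>, act j \<omega>, \<eta> j \<omega>), (x i \<omega>, act i \<omega>)))
       ((\<Pi>\<^sub>M j\<in>{1..<i}. borel \<Otimes>\<^sub>M count_space {1..K} \<Otimes>\<^sub>M borel)
          \<Otimes>\<^sub>M (borel \<Otimes>\<^sub>M count_space {1..K}))"

text \<open>\<^const>\<open>nn_cond_exp\<close> is a default value (constantly 0) unless its second argument is a
  subalgebra of the first; for \<open>history\<close> that is the case.\<close>

lemma subalgebra_history:
  assumes [measurable]: "\<And>j. j \<in> {1..i} \<Longrightarrow> x j \<in> borel_measurable M"
      "\<And>j. j \<in> {1..i} \<Longrightarrow> act j \<in> measurable M (count_space {1..K})"
      "\<And>j. j \<in> {1..i} \<Longrightarrow> \<eta> j \<in> borel_measurable M"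
    and i: "i \<ge> 1"
  shows "subalgebra M (history M K x act \<eta> i)"
proof -
  let ?N = "(\<Pi>\<^sub>M j\<in>{1..<i}. borel \<Otimes>\<^sub>M count_space {1..K} \<Otimes>\<^sub>M borel)
          \<Otimes>\<^sub>M (borel \<Otimes>\<^sub>M count_space {1..K})"
  let ?h = "\<lambda>\<omega>. (\<lambda>j\<in>{1..<i}. (x j \<omega>, act j \<omega>, \<eta> j \<omega>), (x i \<omega>, act i \<omega>))"
  have h: "?h \<in> measurable M ?N"
    using i by (intro measurable_Pair measurable_restrict assms) auto
  have "sets (vimage_algebra (space M) ?h ?N) \<subseteq> sets M"
    unfolding sets_vimage_algebra using measurable_sets[OF h]
    by (intro sets.sigma_sets_subset) auto
  then show ?thesis
    unfolding subalgebra_def history_def by simp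
qed

text \<open>
  The condition on conditional exponential moments uses \<^const>\<open>nn_cond_exp\<close>, which may take the
  value \<open>\<infinity>\<close>; \<^const>\<open>real_cond_exp\<close> would replace \<open>\<infinity>\<close> by 0, so the bound could hold vacuously.
\<close>

definition cond_subgaussian ::
    "'w measure \<Rightarrow> 'w measure \<Rightarrow> real \<Rightarrow> ('w \<Rightarrow> real) \<Rightarrow> bool" where
  "cond_subgaussian M F \<sigma> f \<longleftrightarrow>
     (\<forall>t::real. AE \<omega> in M.
        nn_cond_exp M F (\<lambda>\<omega>'. ennreal (exp (t * f \<omega>'))) \<omega> \<le> ennreal (exp (t\<^sup>2 * \<sigma>\<^sup>2 / 2)))"

text \<open>
  The least-squares estimator for action \<open>a\<close> from the samples 1, ..., N, as a function of the
  observed contexts, the actions and the rewards only.  If no sample has action \<open>a\<close>, or the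
  empirical matrix is singular, its value is an arbitrary one.
\<close>

definition num_chosen :: "(nat \<Rightarrow> nat) \<Rightarrow> nat \<Rightarrow> nat \<Rightarrow> nat" where
  "num_chosen act N a = card {i \<in> {1..N}. act i = a}"

definition b_LS ::
    "(nat \<Rightarrow> real ^ 'l) \<Rightarrow> (nat \<Rightarrow> nat) \<Rightarrow> (nat \<Rightarrow> real) \<Rightarrow> nat \<Rightarrow> nat \<Rightarrow> real ^ 'l" where
  "b_LS xo act r N a =
     matrix_inv ((1 / real (num_chosen act N a)) *\<^sub>R
                   (\<Sum>i\<in>{i \<in> {1..N}. act i = a}. outer (xo i) (xo i)))
     *v ((1 / real (num_chosen act N a)) *\<^sub>R
                   (\<Sum>i\<in>{i \<in> {1..N}. act i = a}. r i *\<^sub>R xo i))"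

end

theory Submission
  imports Defs "HOL-Library.Discrete_Functions" "HOL-Real_Asymp.Real_Asymp"
begin

text \<open>
  Multiply the normal equations by N_a / N.  By the strong law of large numbers N_a / N and the
  averages of \<open>1{a\<^sub>i = a} x\<^sup>o (x\<^sup>o)\<^sup>T\<close> and \<open>1{a\<^sub>i = a} x\<^sup>o (x\<^sup>h)\<^sup>T\<close> converge almost surely to
  \<open>P(a)\<close>, \<open>P(a) R\<^sub>1\<^sub>1(a)\<close> and \<open>P(a) R\<^sub>1\<^sub>2(a)\<close>.  The noise average of \<open>1{a\<^sub>i = a} x\<^sup>o \<eta>\<close> tends to 0:
  conditional subgaussianity makes its terms square integrable martingale differences with
  bounded variance, in particular orthogonal, and for orthogonal variables Chebyshev along the
  squares suffices.  Cramer's rule gives the continuity of the solution of the linear system.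
\<close>

section \<open>Strong law for orthogonal variables\<close>

text \<open>Two different strong laws are used because the averages have different integrability.
  The entries of \<open>R11\<close> and \<open>R12\<close> come with first moments only, so the
  regressor averages need the law for identically distributed integrable variables. The noise terms
  are neither independent nor identically distributed, since the law of the noise may depend on the
  whole history, but they have second moments: integrability of the diagonal of \<open>R11\<close>
  is exactly square integrability of the weights in front of the noise. Conditioning on the action
  is removed at the outset by E[g | a] = E[1{action = a} g] / P(a). All sums then run over the full
  sample with an indicator weight, and no random subsequence of the samples with action
  \<open>a\<close> has to be handled. Mean zero noise is not among the hypotheses; it is extracted
  from the exponential bound near t = 0.\<close>

lemma (in finite_measure) AE_tendsto_zero_of_summable_measure:
  fixes Z :: "nat \<Rightarrow> 'a \<Rightarrow> real"
  assumes [measurable]: "\<And>n. Z n \<in> borel_measurable M"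
    and sm: "\<And>e. e > 0 \<Longrightarrow> summable (\<lambda>n. measure M {x \<in> space M. e \<le> \<bar>Z n x\<bar>})"
  shows "AE x in M. (\<lambda>n. Z n x) \<longlonglongrightarrow> 0"
proof -
  \<comment> \<open>Borel-Cantelli is applied to the thresholds 1 / (j + 1) only, so that the
    exceptional null sets are countably many.\<close>
  define A where "A j n = {x \<in> space M. 1 / real (Suc j) \<le> \<bar>Z n x\<bar>}" for j n
  have "AE x in M. eventually (\<lambda>n. x \<in> space M - A j n) sequentially" for j
    unfolding A_def by (rule borel_cantelli_AE1) (auto intro!: sm simp: less_top[symmetric])
  then have "AE x in M. \<forall>j. eventually (\<lambda>n. x \<in> space M - A j n) sequentially"
    by (simp add: AE_all_countable)
  then show ?thesis
  proof eventually_elim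
    case (elim x)
    show ?case
    proof (rule tendstoI)
      fix e :: real assume "e > 0"
      then obtain j where j: "inverse (of_nat (Suc j)) < e" using reals_Archimedean by blast
      from elim have "eventually (\<lambda>n. x \<in> space M - A j n) sequentially" by blast
      then show "eventually (\<lambda>n. dist (Z n x) 0 < e) sequentially"
        by eventually_elim (use j in \<open>auto simp: A_def divide_inverse\<close>)
    qed
  qed
qed

lemma (in finite_measure) AE_tendsto_zero_of_summable_integral:
  fixes Z :: "nat \<Rightarrow> 'a \<Rightarrow> real"
  assumes int: "\<And>n. integrable M (Z n)" and nonneg: "\<And>n x. 0 \<le> Z n x"
    and sm: "summable (\<lambda>n. \<integral>x. Z n x \<partial>M)"
  shows "AE x in M. (\<lambda>n. Z n x) \<longlonglongrightarrow> 0"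
proof (rule AE_tendsto_zero_of_summable_measure)
  fix e :: real assume e: "e > 0"
  show "summable (\<lambda>n. measure M {x \<in> space M. e \<le> \<bar>Z n x\<bar>})"
  proof (rule summable_comparison_test')
    show "summable (\<lambda>n. (\<integral>x. Z n x \<partial>M) / e)" using sm by (rule summable_divide)
    fix n show "norm (measure M {x \<in> space M. e \<le> \<bar>Z n x\<bar>}) \<le> (\<integral>x. Z n x \<partial>M) / e"
      using integral_Markov_inequality_measure[OF int, of "{}" n e] e nonneg by simp
  qed
qed (use int in auto)

section \<open>Orthogonal sums in L2\<close>

lemma integrable_mult_of_square_integrable:
  fixes f g :: "'a \<Rightarrow> real"
  assumes [measurable]: "f \<in> borel_measurable M" "g \<in> borel_measurable M"
    and f2: "integrable M (\<lambda>x. (f x)\<^sup>2)" and g2: "integrable M (\<lambda>x. (g x)\<^sup>2)"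
  shows "integrable M (\<lambda>x. f x * g x)"
proof (rule Bochner_Integration.integrable_bound)
  show "integrable M (\<lambda>x. (f x)\<^sup>2 + (g x)\<^sup>2)" using f2 g2 by simp
  show "AE x in M. norm (f x * g x) \<le> norm ((f x)\<^sup>2 + (g x)\<^sup>2)"
  proof (rule AE_I2)
    fix x
    have "2 * (\<bar>f x\<bar> * \<bar>g x\<bar>) \<le> (f x)\<^sup>2 + (g x)\<^sup>2"
      using sum_squares_bound[of "\<bar>f x\<bar>" "\<bar>g x\<bar>"] by (simp add: mult.assoc)
    moreover have "0 \<le> \<bar>f x\<bar> * \<bar>g x\<bar>" by simp
    ultimately show "norm (f x * g x) \<le> norm ((f x)\<^sup>2 + (g x)\<^sup>2)"
      unfolding real_norm_def abs_mult by linarith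
  qed
qed simp

lemma
  fixes Y :: "'i \<Rightarrow> 'a \<Rightarrow> real"
  assumes meas: "\<And>i. i \<in> I \<Longrightarrow> Y i \<in> borel_measurable M"
    and sq: "\<And>i. i \<in> I \<Longrightarrow> integrable M (\<lambda>x. (Y i x)\<^sup>2)"
    and orth: "\<And>i j. i \<in> I \<Longrightarrow> j \<in> I \<Longrightarrow> i \<noteq> j \<Longrightarrow> (\<integral>x. Y i x * Y j x \<partial>M) = 0"
    and fin: "finite I"
  shows integrable_square_sum: "integrable M (\<lambda>x. (\<Sum>i\<in>I. Y i x)\<^sup>2)"
    and integral_square_sum_orthogonal:
      "(\<integral>x. (\<Sum>i\<in>I. Y i x)\<^sup>2 \<partial>M) = (\<Sum>i\<in>I. \<integral>x. (Y i x)\<^sup>2 \<partial>M)"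
proof -
  have eq: "(\<lambda>x. (\<Sum>i\<in>I. Y i x)\<^sup>2) = (\<lambda>x. \<Sum>i\<in>I. \<Sum>j\<in>I. Y i x * Y j x)"
    by (simp add: power2_eq_square sum_product)
  have int: "integrable M (\<lambda>x. Y i x * Y j x)" if "i \<in> I" "j \<in> I" for i j
    using that by (intro integrable_mult_of_square_integrable meas sq)
  show "integrable M (\<lambda>x. (\<Sum>i\<in>I. Y i x)\<^sup>2)"
    unfolding eq by (intro Bochner_Integration.integrable_sum int)
  have "(\<integral>x. (\<Sum>i\<in>I. Y i x)\<^sup>2 \<partial>M) = (\<Sum>i\<in>I. \<Sum>j\<in>I. \<integral>x. Y i x * Y j x \<partial>M)"
    unfolding eq
    by (subst Bochner_Integration.integral_sum, intro Bochner_Integration.integrable_sum int; simp?)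
       (intro sum.cong refl Bochner_Integration.integral_sum int)
  also have "\<dots> = (\<Sum>i\<in>I. \<Sum>j\<in>I. if j = i then \<integral>x. (Y i x)\<^sup>2 \<partial>M else 0)"
    by (intro sum.cong refl) (auto simp: orth power2_eq_square)
  finally show "(\<integral>x. (\<Sum>i\<in>I. Y i x)\<^sup>2 \<partial>M) = (\<Sum>i\<in>I. \<integral>x. (Y i x)\<^sup>2 \<partial>M)"
    using fin by simp
qed

text \<open>The sum of the first n^2 variables has second moment at most n^2 C, which is summable
  over n after division by n^4. The block from n^2 to (n + 1)^2 is so short, at most 2 n + 1 terms,
  that the crude replacement of the maximal increment by the sum of all squared increments still
  leaves order n^2; no maximal inequality is required.\<close>

theorem (in finite_measure) strong_law_orthogonal:
  fixes Y :: "nat \<Rightarrow> 'a \<Rightarrow> real"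
  assumes meas[measurable]: "\<And>i. Y i \<in> borel_measurable M"
    and sq: "\<And>i. integrable M (\<lambda>x. (Y i x)\<^sup>2)"
    and orth: "\<And>i j. i \<noteq> j \<Longrightarrow> (\<integral>x. Y i x * Y j x \<partial>M) = 0"
    and bound: "\<And>i. (\<integral>x. (Y i x)\<^sup>2 \<partial>M) \<le> C"
  shows "AE x in M. (\<lambda>n. (\<Sum>i<n. Y i x) / real n) \<longlonglongrightarrow> 0"
proof -
  have C: "0 \<le> C" by (rule order_trans[OF _ bound[of 0]]) simp
  define S where "S n x = (\<Sum>i<n. Y i x)" for n x
  define J where "J n = {n\<^sup>2..<(Suc n)\<^sup>2}" for n :: nat
  \<comment> \<open>One nonnegative variable per block controls both the sum at the start of the
    block and every increment inside it.\<close>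
  define W where "W n x = ((S (n\<^sup>2) x)\<^sup>2 + (\<Sum>m\<in>J n. (\<Sum>i\<in>{n\<^sup>2..<m}. Y i x)\<^sup>2)) / real n ^ 4" for n x
  have intS: "integrable M (\<lambda>x. (S n x)\<^sup>2)" for n
    unfolding S_def by (rule integrable_square_sum) (auto intro: sq orth)
  have intI: "integrable M (\<lambda>x. (\<Sum>i\<in>{k..<m}. Y i x)\<^sup>2)" for k m
    by (rule integrable_square_sum) (auto intro: sq orth)
  have "AE x in M. (\<lambda>n. W n x) \<longlonglongrightarrow> 0"
  proof (rule AE_tendsto_zero_of_summable_integral)
    show "integrable M (W n)" for n unfolding W_def using intS intI by auto
    show "0 \<le> W n x" for n x unfolding W_def by (auto intro!: divide_nonneg_nonneg add_nonneg_nonneg sum_nonneg)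
    \<comment> \<open>The constant is 1 + 9: n^2 C from the start of the block and (2 n + 1)^2 C
      \<le> (3 n)^2 C from the increments. For n = 0 both sides are 0 because division by 0 yields
      0.\<close>
    have EW: "(\<integral>x. W n x \<partial>M) \<le> 10 * C / real n ^ 2" for n
    proof (cases "n = 0")
      case True then show ?thesis by (simp add: W_def)
    next
      case False
      have EI: "(\<integral>x. (\<Sum>i\<in>{n\<^sup>2..<m}. Y i x)\<^sup>2 \<partial>M) \<le> (2 * real n + 1) * C" if "m \<in> J n" for m
      proof -
        have "(\<integral>x. (\<Sum>i\<in>{n\<^sup>2..<m}. Y i x)\<^sup>2 \<partial>M) = (\<Sum>i\<in>{n\<^sup>2..<m}. \<integral>x. (Y i x)\<^sup>2 \<partial>M)"
          by (rule integral_square_sum_orthogonal) (auto intro: sq orth)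
        also have "\<dots> \<le> real (card {n\<^sup>2..<m}) * C"
          by (rule sum_bounded_above) (rule bound)
        also have "\<dots> \<le> (2 * real n + 1) * C"
        proof (rule mult_right_mono[OF _ C])
          have "m - n\<^sup>2 \<le> 2 * n + 1" using that by (auto simp: J_def power2_eq_square)
          then show "real (card {n\<^sup>2..<m}) \<le> 2 * real n + 1" by simp
        qed
        finally show ?thesis .
      qed
      have ES: "(\<integral>x. (S (n\<^sup>2) x)\<^sup>2 \<partial>M) \<le> real n ^ 2 * C"
      proof -
        have "(\<integral>x. (S (n\<^sup>2) x)\<^sup>2 \<partial>M) = (\<Sum>i<n\<^sup>2. \<integral>x. (Y i x)\<^sup>2 \<partial>M)"
          unfolding S_def by (rule integral_square_sum_orthogonal) (auto intro: sq orth)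
        also have "\<dots> \<le> real (card {..<n\<^sup>2}) * C"
          by (rule sum_bounded_above) (rule bound)
        finally show ?thesis by simp
      qed
      have "(\<integral>x. W n x \<partial>M) = ((\<integral>x. (S (n\<^sup>2) x)\<^sup>2 \<partial>M) +
          (\<Sum>m\<in>J n. \<integral>x. (\<Sum>i\<in>{n\<^sup>2..<m}. Y i x)\<^sup>2 \<partial>M)) / real n ^ 4"
        unfolding W_def using intS intI by simp
      also have "\<dots> \<le> (real n ^ 2 * C + real (card (J n)) * ((2 * real n + 1) * C)) / real n ^ 4"
        by (intro divide_right_mono add_mono ES sum_bounded_above EI) auto
      also have "real (card (J n)) = 2 * real n + 1" by (simp add: J_def power2_eq_square)
      also have "(real n ^ 2 * C + (2 * real n + 1) * ((2 * real n + 1) * C)) / real n ^ 4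
          \<le> (10 * C * real n ^ 2) / real n ^ 4"
      proof (rule divide_right_mono)
        have "2 * real n + 1 \<le> 3 * real n" using False by simp
        then have "(2 * real n + 1) * (2 * real n + 1) \<le> (3 * real n) * (3 * real n)"
          by (intro mult_mono) auto
        then have "(2 * real n + 1) * (2 * real n + 1) * C \<le> (3 * real n) * (3 * real n) * C"
          using C by (rule mult_right_mono)
        then show "real n ^ 2 * C + (2 * real n + 1) * ((2 * real n + 1) * C) \<le> 10 * C * real n ^ 2"
          by (simp add: power2_eq_square algebra_simps)
      qed simp
      also have "\<dots> = 10 * C / real n ^ 2" using False by (simp add: field_simps power_numeral_reduce)
      finally show ?thesis .
    qed
    show "summable (\<lambda>n. \<integral>x. W n x \<partial>M)"
    proof (rule summable_comparison_test')
      show "summable (\<lambda>n. 10 * C / real n ^ 2)"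
        using summable_mult[OF inverse_power_summable[of 2, where 'a = real], of "10 * C"]
        by (simp add: divide_inverse)
      fix n show "norm (\<integral>x. W n x \<partial>M) \<le> 10 * C / real n ^ 2"
        using EW[of n] integral_nonneg_AE[of "W n" M] \<open>\<And>n x. 0 \<le> W n x\<close> by simp
    qed
  qed
  then show ?thesis
  proof eventually_elim
    case (elim x)
    \<comment> \<open>The block containing m has index \<open>floor_sqrt m\<close>, and this index
      tends to infinity with m.\<close>
    have fs: "filterlim floor_sqrt at_top sequentially"
      unfolding filterlim_at_top
    proof
      fix Z :: nat
      show "eventually (\<lambda>m. Z \<le> floor_sqrt m) sequentially"
        using eventually_ge_at_top[of "Z\<^sup>2"]
        by eventually_elim (metis floor_sqrt_inverse_power2 mono_floor_sqrt')
    qed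
    have lim: "(\<lambda>m. sqrt (2 * W (floor_sqrt m) x)) \<longlonglongrightarrow> sqrt (2 * 0)"
      by (intro tendsto_intros filterlim_compose[OF elim fs])
    have "eventually (\<lambda>m. norm ((\<Sum>i<m. Y i x) / real m) \<le> sqrt (2 * W (floor_sqrt m) x)) sequentially"
      using eventually_gt_at_top[of 0]
    proof eventually_elim
      case (elim m)
      define n where "n = floor_sqrt m"
      have n: "n > 0" "n\<^sup>2 \<le> m" "m \<in> J n"
        using elim Suc_floor_sqrt_power2_gt[of m] by (auto simp: n_def J_def)
      define a where "a = S (n\<^sup>2) x"
      define b where "b = (\<Sum>i\<in>{n\<^sup>2..<m}. Y i x)"
      have ab: "(\<Sum>i<m. Y i x) = a + b"
        unfolding a_def b_def S_def using n(2) by (simp add: lessThan_atLeast0 sum.atLeastLessThan_concat)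
      have "b\<^sup>2 \<le> (\<Sum>m\<in>J n. (\<Sum>i\<in>{n\<^sup>2..<m}. Y i x)\<^sup>2)"
        unfolding b_def by (rule member_le_sum[OF n(3)]) (auto simp: J_def)
      then have bb: "(a\<^sup>2 + b\<^sup>2) / real n ^ 4 \<le> W n x"
        unfolding W_def a_def by (intro divide_right_mono) auto
      \<comment> \<open>Since m is at least n^2, replacing the denominator by n^2 only enlarges the
        quotient; the factor 2 under the root comes from (a + b)^2 \<le> 2 (a^2 + b^2).\<close>
      have "((a + b) / real m)\<^sup>2 \<le> (a + b)\<^sup>2 / real n ^ 4"
      proof -
        have "real n ^ 4 = (real (n\<^sup>2))\<^sup>2" by simp
        also have "\<dots> \<le> (real m)\<^sup>2" using n(2) by (intro power_mono) (auto simp del: of_nat_power)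
        finally have "real n ^ 4 \<le> (real m)\<^sup>2" .
        then show ?thesis unfolding power_divide using n(1) elim
          by (intro divide_left_mono) auto
      qed
      also have "\<dots> \<le> 2 * (a\<^sup>2 + b\<^sup>2) / real n ^ 4"
        using sum_squares_bound[of a b] by (intro divide_right_mono) (auto simp: power2_sum)
      also have "\<dots> \<le> 2 * W n x" using mult_left_mono[OF bb, of 2] by simp
      finally have "\<bar>(a + b) / real m\<bar> \<le> sqrt (2 * W n x)" by (rule real_le_rsqrt[of "\<bar>_\<bar>", simplified])
      then show ?case unfolding ab n_def by simp
    qed
    from Lim_null_comparison[OF this] lim show ?case by simp
  qed
qed

section \<open>Strong law of large numbers\<close>

text \<open>Both sums are geometric and dominated by the powers of \<alpha> near x: the powers below
  x add up to at most \<alpha> x / (\<alpha> - 1), and so does x^2 times the sum of the reciprocals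
  of the powers above x. After taking expectations, the first part pays for the variables that
  exceed the truncation level and the second for the variances of the truncated ones.\<close>

lemma sum_geometric_truncation_le:
  fixes x \<alpha> :: real
  assumes \<alpha>: "\<alpha> > 1" and x: "x \<ge> 0"
  shows "(\<Sum>n<N. \<alpha> ^ n * indicator {\<alpha> ^ n<..} x + (indicator {0..\<alpha> ^ n} x * x)\<^sup>2 / \<alpha> ^ n)
    \<le> 2 * \<alpha> / (\<alpha> - 1) * x"
proof -
  \<comment> \<open>The minimum makes the induction close: while \<open>\<alpha> ^ N < x\<close> the
    bound is the growing geometric sum, and once x is passed nothing more is added and
    \<open>\<alpha> * x\<close> is the cap.\<close>
  have tail: "(\<Sum>n<N. \<alpha> ^ n * indicator {\<alpha> ^ n<..} x) \<le> min (\<alpha> ^ N) (\<alpha> * x) / (\<alpha> - 1)" for N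
  proof (induction N)
    case 0 then show ?case using \<alpha> x by simp
  next
    case (Suc N)
    show ?case
    proof (cases "\<alpha> ^ N < x")
      case True
      then have le: "\<alpha> ^ Suc N \<le> \<alpha> * x" using \<alpha> by simp
      have "(\<Sum>n<Suc N. \<alpha> ^ n * indicator {\<alpha> ^ n<..} x) \<le> \<alpha> ^ N / (\<alpha> - 1) + \<alpha> ^ N"
      proof -
        have "min (\<alpha> ^ N) (\<alpha> * x) / (\<alpha> - 1) \<le> \<alpha> ^ N / (\<alpha> - 1)"
          using \<alpha> by (intro divide_right_mono) auto
        then show ?thesis using Suc True by simp
      qed
      also have "\<dots> = \<alpha> ^ Suc N / (\<alpha> - 1)" using \<alpha> by (simp add: field_simps)
      finally show ?thesis using le by (simp only: min_absorb1)
    next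
      case False
      have "(\<Sum>n<Suc N. \<alpha> ^ n * indicator {\<alpha> ^ n<..} x) \<le> min (\<alpha> ^ N) (\<alpha> * x) / (\<alpha> - 1)"
        using Suc False by (simp add: indicator_def)
      also have "\<dots> \<le> min (\<alpha> ^ Suc N) (\<alpha> * x) / (\<alpha> - 1)"
        using \<alpha> by (intro divide_right_mono min.mono power_increasing) auto
      finally show ?thesis .
    qed
  qed
  \<comment> \<open>The amount subtracted accounts for the terms still to come:
    \<open>\<alpha> / (\<alpha> - 1) * (x\<^sup>2 / \<alpha> ^ N)\<close> is the sum of
    \<open>x\<^sup>2 / \<alpha> ^ n\<close> over all n \<ge> N. As long as
    \<open>\<alpha> ^ N < x\<close> the minimum is x and the bound is 0.\<close>
  have main: "(\<Sum>n<N. (indicator {0..\<alpha> ^ n} x * x)\<^sup>2 / \<alpha> ^ n)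
      \<le> \<alpha> / (\<alpha> - 1) * (x - min x (x\<^sup>2 / \<alpha> ^ N))" for N
  proof (induction N)
    case 0 then show ?case using \<alpha> x by simp
  next
    case (Suc N)
    have dec: "x\<^sup>2 / \<alpha> ^ Suc N \<le> x\<^sup>2 / \<alpha> ^ N"
      using \<alpha> by (intro divide_left_mono power_increasing) auto
    show ?case
    proof (cases "x \<le> \<alpha> ^ N")
      case True
      have le: "x\<^sup>2 / \<alpha> ^ N \<le> x"
        using True \<alpha> x by (simp add: field_simps power2_eq_square mult_left_mono)
      have "(\<Sum>n<Suc N. (indicator {0..\<alpha> ^ n} x * x)\<^sup>2 / \<alpha> ^ n)
          \<le> \<alpha> / (\<alpha> - 1) * (x - x\<^sup>2 / \<alpha> ^ N) + x\<^sup>2 / \<alpha> ^ N"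
        using Suc True le x by (simp add: indicator_def min_absorb2)
      also have "\<dots> = \<alpha> / (\<alpha> - 1) * (x - x\<^sup>2 / \<alpha> ^ Suc N)"
        using \<alpha> by (simp add: field_simps)
      also have "x\<^sup>2 / \<alpha> ^ Suc N = min x (x\<^sup>2 / \<alpha> ^ Suc N)" using le dec by linarith
      finally show ?thesis .
    next
      case False
      have "(\<Sum>n<Suc N. (indicator {0..\<alpha> ^ n} x * x)\<^sup>2 / \<alpha> ^ n)
          \<le> \<alpha> / (\<alpha> - 1) * (x - min x (x\<^sup>2 / \<alpha> ^ N))"
        using Suc False by (simp add: indicator_def)
      also have "\<dots> \<le> \<alpha> / (\<alpha> - 1) * (x - min x (x\<^sup>2 / \<alpha> ^ Suc N))"
        using \<alpha> dec by (intro mult_left_mono diff_left_mono min.mono) auto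
      finally show ?thesis .
    qed
  qed
  have "min (\<alpha> ^ N) (\<alpha> * x) / (\<alpha> - 1) \<le> \<alpha> * x / (\<alpha> - 1)"
    using \<alpha> by (intro divide_right_mono) auto
  moreover have "\<alpha> / (\<alpha> - 1) * (x - min x (x\<^sup>2 / \<alpha> ^ N)) \<le> \<alpha> / (\<alpha> - 1) * x"
    using \<alpha> x by (intro mult_left_mono) auto
  moreover have "2 * \<alpha> / (\<alpha> - 1) * x = \<alpha> * x / (\<alpha> - 1) + \<alpha> / (\<alpha> - 1) * x" by simp
  ultimately show ?thesis using tail[of N] main[of N] by (simp only: sum.distrib)
qed

text \<open>
  Etemadi's argument, except that the truncation level at stage n is \<open>\<alpha> ^ n\<close> for all variables
  simultaneously; then the truncation errors and the variances are summed at once by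
  \<open>sum_geometric_truncation_le\<close>.
\<close>

lemma (in prob_space) AE_tendsto_average_geometric:
  fixes X :: "nat \<Rightarrow> 'a \<Rightarrow> real" and \<alpha> :: real
  assumes indep: "\<And>i j. i \<noteq> j \<Longrightarrow> indep_var borel (X i) borel (X j)"
    and distr: "\<And>i. distr M borel (X i) = distr M borel (X 0)"
    and int: "integrable M (X 0)"
    and nonneg: "\<And>i \<omega>. \<omega> \<in> space M \<Longrightarrow> 0 \<le> X i \<omega>"
    and \<alpha>: "\<alpha> > 1"
  shows "AE \<omega> in M. (\<lambda>n. (\<Sum>i<nat \<lceil>\<alpha> ^ n\<rceil>. X i \<omega>) / real (nat \<lceil>\<alpha> ^ n\<rceil>)) \<longlonglongrightarrow> expectation (X 0)"
proof -
  have meas[measurable]: "random_variable borel (X i)" for i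
    by (rule indep_var_rv1[OF indep[of i "Suc i"]]) simp
  define k where "k n = nat \<lceil>\<alpha> ^ n\<rceil>" for n
  have \<alpha>n: "\<alpha> ^ n \<ge> 1" for n using \<alpha> by (simp add: one_le_power)
  \<comment> \<open>Rounding up at most doubles the power because \<open>\<alpha> ^ n\<close> is at
    least 1.\<close>
  have k: "k n > 0" "\<alpha> ^ n \<le> real (k n)" "real (k n) \<le> 2 * \<alpha> ^ n" for n
    using \<alpha>n[of n] unfolding k_def by linarith+
  define t where "t n y = indicator {0..\<alpha> ^ n} y * y" for n and y :: real
  have t_meas[measurable]: "t n \<in> borel_measurable borel" for n unfolding t_def[abs_def] by measurable
  have t_bound: "\<bar>t n y\<bar> \<le> \<alpha> ^ n" for n y using \<alpha>n[of n] by (auto simp: t_def indicator_def)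
  have t2_bound: "(t n y)\<^sup>2 \<le> (\<alpha> ^ n)\<^sup>2" for n y
    using power_mono[OF t_bound[of n y], of 2] by simp
  have Eeq: "expectation (\<lambda>\<omega>. f (X i \<omega>)) = expectation (\<lambda>\<omega>. f (X 0 \<omega>))"
    if [measurable]: "f \<in> borel_measurable borel" for f :: "real \<Rightarrow> real" and i
    using integral_distr[of "X i" M borel f] integral_distr[of "X 0" M borel f] distr[of i] by simp
  define m where "m n = expectation (\<lambda>\<omega>. t n (X 0 \<omega>))" for n
  have int_t: "integrable M (\<lambda>\<omega>. t n (X i \<omega>))" for n i
    by (rule integrable_const_bound[of _ "\<alpha> ^ n"]) (auto simp: t_bound)
  have int_t2: "integrable M (\<lambda>\<omega>. (t n (X i \<omega>))\<^sup>2)" for n i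
    by (rule integrable_const_bound[of _ "(\<alpha> ^ n)\<^sup>2"]) (auto simp: t2_bound)
  have mean: "expectation (\<lambda>\<omega>. t n (X i \<omega>)) = m n" for n i
    unfolding m_def by (rule Eeq) simp
  \<comment> \<open>This is the summand of \<open>sum_geometric_truncation_le\<close>; its
    expectations are therefore summable, with total at most
    \<open>2 * \<alpha> / (\<alpha> - 1)\<close> times the mean of \<open>X 0\<close>.\<close>
  define g where "g n y = \<alpha> ^ n * indicator {\<alpha> ^ n<..} y + (t n y)\<^sup>2 / \<alpha> ^ n" for n y
  have int_ind: "integrable M (\<lambda>\<omega>. indicator {\<alpha> ^ n<..} (X 0 \<omega>) :: real)" for n
    by (rule integrable_const_bound[of _ 1]) (auto simp: indicator_def)
  have int_g: "integrable M (\<lambda>\<omega>. g n (X 0 \<omega>))" for n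
    unfolding g_def using int_ind int_t2 by simp
  have g_nonneg: "0 \<le> g n y" for n y using \<alpha>n[of n] by (auto simp: g_def)
  have sum_g: "summable (\<lambda>n. expectation (\<lambda>\<omega>. g n (X 0 \<omega>)))"
  proof (rule summableI_nonneg_bounded)
    show "0 \<le> expectation (\<lambda>\<omega>. g n (X 0 \<omega>))" for n by (simp add: g_nonneg)
    fix N
    have "(\<Sum>n<N. expectation (\<lambda>\<omega>. g n (X 0 \<omega>))) = expectation (\<lambda>\<omega>. \<Sum>n<N. g n (X 0 \<omega>))"
      using int_g by simp
    also have "\<dots> \<le> expectation (\<lambda>\<omega>. 2 * \<alpha> / (\<alpha> - 1) * X 0 \<omega>)"
      using int_g int sum_geometric_truncation_le[OF \<alpha> nonneg]
      by (intro integral_mono) (auto simp: g_def t_def)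
    finally show "(\<Sum>n<N. expectation (\<lambda>\<omega>. g n (X 0 \<omega>))) \<le> expectation (\<lambda>\<omega>. 2 * \<alpha> / (\<alpha> - 1) * X 0 \<omega>)" .
  qed
  \<comment> \<open>The centring is by the truncated mean \<open>m n\<close>, which lets the
    probability bounds be summed; the true mean is recovered separately by dominated
    convergence.\<close>
  define Z where "Z n \<omega> = (\<Sum>i<k n. X i \<omega>) / real (k n) - m n" for n \<omega>
  have Z0: "AE \<omega> in M. (\<lambda>n. Z n \<omega>) \<longlonglongrightarrow> 0"
  proof (rule AE_tendsto_zero_of_summable_measure)
    show "Z n \<in> borel_measurable M" for n unfolding Z_def by measurable
    fix e :: real assume e: "e > 0"
    \<comment> \<open>The 2 comes from \<open>k n\<close> being at most
      \<open>2 * \<alpha> ^ n\<close> in the union bound for truncated variables, the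
      \<open>1 / e\<^sup>2\<close> from Chebyshev for the truncated sum.\<close>
    have "prob {\<omega> \<in> space M. e \<le> \<bar>Z n \<omega>\<bar>} \<le> (2 + 1 / e\<^sup>2) * expectation (\<lambda>\<omega>. g n (X 0 \<omega>))" for n
    proof -
      define Y where "Y i \<omega> = t n (X i \<omega>) - m n" for i \<omega>
      define V where "V \<omega> = ((\<Sum>i<k n. Y i \<omega>) / real (k n))\<^sup>2" for \<omega>
      have Y_meas[measurable]: "Y i \<in> borel_measurable M" for i unfolding Y_def by measurable
      have Y_sq: "integrable M (\<lambda>\<omega>. (Y i \<omega>)\<^sup>2)" for i
        unfolding Y_def power2_diff using int_t int_t2 by simp
      have Y_int: "integrable M (Y i)" for i unfolding Y_def using int_t by simp
      have Y_mean: "expectation (Y i) = 0" for i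
        unfolding Y_def using int_t mean by (simp add: prob_space)
      have Y_indep: "indep_var borel (Y i) borel (Y j)" if "i \<noteq> j" for i j
        using indep_var_compose[OF indep[OF that], of "\<lambda>y. t n y - m n" borel "\<lambda>y. t n y - m n" borel]
        by (simp add: Y_def[abs_def] comp_def)
      have orth: "expectation (\<lambda>\<omega>. Y i \<omega> * Y j \<omega>) = 0" if "i \<noteq> j" for i j
        using indep_var_lebesgue_integral[OF Y_indep[OF that] Y_int Y_int] Y_mean by simp
      have Y_var: "expectation (\<lambda>\<omega>. (Y i \<omega>)\<^sup>2) \<le> expectation (\<lambda>\<omega>. (t n (X 0 \<omega>))\<^sup>2)" for i
      proof -
        have "expectation (\<lambda>\<omega>. (Y i \<omega>)\<^sup>2) = expectation (\<lambda>\<omega>. (t n (X i \<omega>))\<^sup>2) - (m n)\<^sup>2"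
          using variance_eq[OF int_t int_t2, of n i] unfolding Y_def mean by simp
        also have "expectation (\<lambda>\<omega>. (t n (X i \<omega>))\<^sup>2) = expectation (\<lambda>\<omega>. (t n (X 0 \<omega>))\<^sup>2)"
          by (rule Eeq[of "\<lambda>y. (t n y)\<^sup>2"]) simp
        finally show ?thesis by simp
      qed
      have V_int: "integrable M V"
        unfolding V_def power_divide using integrable_square_sum[of "{..<k n}" Y M] Y_sq orth by simp
      have V_mean: "expectation V \<le> expectation (\<lambda>\<omega>. (t n (X 0 \<omega>))\<^sup>2) / \<alpha> ^ n"
      proof -
        have "expectation V = (\<Sum>i<k n. expectation (\<lambda>\<omega>. (Y i \<omega>)\<^sup>2)) / (real (k n))\<^sup>2"
          unfolding V_def power_divide
          using integral_square_sum_orthogonal[of "{..<k n}" Y M] Y_sq orth by simp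
        also have "\<dots> \<le> (real (card {..<k n}) * expectation (\<lambda>\<omega>. (t n (X 0 \<omega>))\<^sup>2)) / (real (k n))\<^sup>2"
          by (intro divide_right_mono sum_bounded_above Y_var) auto
        also have "\<dots> = expectation (\<lambda>\<omega>. (t n (X 0 \<omega>))\<^sup>2) / real (k n)"
          using k(1)[of n] by (simp add: power2_eq_square)
        also have "\<dots> \<le> expectation (\<lambda>\<omega>. (t n (X 0 \<omega>))\<^sup>2) / \<alpha> ^ n"
          using k[of n] \<alpha>n[of n] by (intro divide_left_mono) auto
        finally show ?thesis .
      qed
      let ?T = "\<lambda>i. {\<omega> \<in> space M. \<alpha> ^ n < X i \<omega>}"
      have probT: "prob (?T i) = expectation (\<lambda>\<omega>. indicator {\<alpha> ^ n<..} (X 0 \<omega>))" for i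
      proof -
        have "prob (?T i) = expectation (indicator (?T i))" by simp
        also have "\<dots> = expectation (\<lambda>\<omega>. indicator {\<alpha> ^ n<..} (X i \<omega>))"
          by (rule Bochner_Integration.integral_cong) (auto simp: indicator_def)
        also have "\<dots> = expectation (\<lambda>\<omega>. indicator {\<alpha> ^ n<..} (X 0 \<omega>))" by (rule Eeq) simp
        finally show ?thesis .
      qed
      have V_meas[measurable]: "V \<in> borel_measurable M" unfolding V_def by measurable
      \<comment> \<open>If none of the \<open>k n\<close> variables exceeds the common level,
        truncation changes nothing and \<open>V\<close> is the square of \<open>Z n\<close>.\<close>
      have "prob {\<omega> \<in> space M. e \<le> \<bar>Z n \<omega>\<bar>} \<le> prob ((\<Union>i<k n. ?T i) \<union> {\<omega> \<in> space M. e\<^sup>2 \<le> V \<omega>})"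
      proof (rule finite_measure_mono)
        show "{\<omega> \<in> space M. e \<le> \<bar>Z n \<omega>\<bar>} \<subseteq> (\<Union>i<k n. ?T i) \<union> {\<omega> \<in> space M. e\<^sup>2 \<le> V \<omega>}"
        proof
          fix \<omega> assume \<omega>: "\<omega> \<in> {\<omega> \<in> space M. e \<le> \<bar>Z n \<omega>\<bar>}"
          show "\<omega> \<in> (\<Union>i<k n. ?T i) \<union> {\<omega> \<in> space M. e\<^sup>2 \<le> V \<omega>}"
          proof (cases "\<exists>i<k n. \<alpha> ^ n < X i \<omega>")
            case True then show ?thesis using \<omega> by auto
          next
            case False
            then have "t n (X i \<omega>) = X i \<omega>" if "i < k n" for i
              using False[simplified not_ex, rule_format, of i] that \<omega> nonneg[of \<omega> i]
              by (simp add: t_def not_less)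
            then have "(\<Sum>i<k n. Y i \<omega>) = (\<Sum>i<k n. X i \<omega>) - real (k n) * m n"
              unfolding Y_def by (simp add: sum_subtractf)
            then have "V \<omega> = (Z n \<omega>)\<^sup>2" unfolding V_def Z_def using k(1)[of n]
              by (simp add: diff_divide_distrib)
            then have "V \<omega> = \<bar>Z n \<omega>\<bar>\<^sup>2" by simp
            also have "\<bar>Z n \<omega>\<bar>\<^sup>2 \<ge> e\<^sup>2" using \<omega> e by (intro power_mono) auto
            finally show ?thesis using \<omega> by simp
          qed
        qed
      qed measurable
      also have "\<dots> \<le> prob (\<Union>i<k n. ?T i) + prob {\<omega> \<in> space M. e\<^sup>2 \<le> V \<omega>}"
        by (rule measure_Un_le) measurable
      also have "prob (\<Union>i<k n. ?T i) \<le> (\<Sum>i<k n. prob (?T i))"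
        by (rule measure_UNION_le) auto
      also have "(\<Sum>i<k n. prob (?T i)) = real (k n) * expectation (\<lambda>\<omega>. indicator {\<alpha> ^ n<..} (X 0 \<omega>))"
        unfolding probT by simp
      also have "\<dots> \<le> 2 * \<alpha> ^ n * expectation (\<lambda>\<omega>. indicator {\<alpha> ^ n<..} (X 0 \<omega>))"
        using k(3) by (rule mult_right_mono) simp
      also have "prob {\<omega> \<in> space M. e\<^sup>2 \<le> V \<omega>} \<le> expectation V / e\<^sup>2"
        using e by (intro integral_Markov_inequality_measure[OF V_int, of "{}"]) (auto simp: V_def)
      also have "\<dots> \<le> expectation (\<lambda>\<omega>. (t n (X 0 \<omega>))\<^sup>2) / \<alpha> ^ n / e\<^sup>2"
        by (rule divide_right_mono[OF V_mean]) simp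
      finally have 1: "prob {\<omega> \<in> space M. e \<le> \<bar>Z n \<omega>\<bar>} \<le> 2 * (\<alpha> ^ n * expectation (\<lambda>\<omega>. indicator {\<alpha> ^ n<..} (X 0 \<omega>)))
         + 1 / e\<^sup>2 * (expectation (\<lambda>\<omega>. (t n (X 0 \<omega>))\<^sup>2) / \<alpha> ^ n)" by (simp add: mult_ac)
      have 2: "expectation (\<lambda>\<omega>. g n (X 0 \<omega>)) = \<alpha> ^ n * expectation (\<lambda>\<omega>. indicator {\<alpha> ^ n<..} (X 0 \<omega>))
          + expectation (\<lambda>\<omega>. (t n (X 0 \<omega>))\<^sup>2) / \<alpha> ^ n"
        unfolding g_def using int_ind int_t2 by simp
      have 3: "2 * a + b * c \<le> (2 + b) * (a + c)" if "0 \<le> a" "0 \<le> b" "0 \<le> c" for a b c :: real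
        using mult_nonneg_nonneg[OF that(1,2)] that by (simp add: algebra_simps)
      show ?thesis unfolding 2
        by (rule order_trans[OF 1]) (rule 3, use \<alpha>n[of n] in auto)
    qed
    then show "summable (\<lambda>n. prob {\<omega> \<in> space M. e \<le> \<bar>Z n \<omega>\<bar>})"
      by (intro summable_comparison_test'[OF summable_mult[OF sum_g]]) auto
  qed
  \<comment> \<open>\<open>X 0\<close> is an integrable majorant of its truncations, and each fixed
    value is eventually below the level \<open>\<alpha> ^ n\<close>.\<close>
  have m_lim: "m \<longlonglongrightarrow> expectation (X 0)"
    unfolding m_def
  proof (rule integral_dominated_convergence)
    show "integrable M (\<lambda>\<omega>. \<bar>X 0 \<omega>\<bar>)" using int by simp
    show "AE \<omega> in M. (\<lambda>n. t n (X 0 \<omega>)) \<longlonglongrightarrow> X 0 \<omega>"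
    proof (rule AE_I2)
      fix \<omega> assume \<omega>: "\<omega> \<in> space M"
      have "filterlim (\<lambda>n. \<alpha> ^ n) at_top sequentially"
        using \<alpha> by real_asymp
      then have "eventually (\<lambda>n. X 0 \<omega> \<le> \<alpha> ^ n) sequentially" by (simp add: filterlim_at_top)
      then have "eventually (\<lambda>n. t n (X 0 \<omega>) = X 0 \<omega>) sequentially"
        by eventually_elim (use nonneg[OF \<omega>] in \<open>auto simp: t_def\<close>)
      then show "(\<lambda>n. t n (X 0 \<omega>)) \<longlonglongrightarrow> X 0 \<omega>" by (rule tendsto_eventually)
    qed
    show "AE \<omega> in M. norm (t n (X 0 \<omega>)) \<le> \<bar>X 0 \<omega>\<bar>" for n
      by (auto simp: t_def indicator_def)
  qed auto
  from Z0 show ?thesis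
  proof eventually_elim
    case (elim \<omega>)
    from tendsto_add[OF this m_lim] show ?case by (simp add: Z_def k_def)
  qed
qed

text \<open>For N between two consecutive grid points, monotonicity encloses the average at N
  between the averages at these points, up to a factor that tends to the ratio of the grid. The
  ratios 1 + 1 / (j + 1) come arbitrarily close to 1, and there are only countably many of them, so
  that an almost sure statement for each of them holds for all simultaneously.\<close>

lemma tendsto_average_of_geometric:
  fixes S :: "nat \<Rightarrow> real"
  assumes mono: "mono S" and nonneg: "\<And>n. 0 \<le> S n"
    and lim: "\<And>j. (\<lambda>n. S (nat \<lceil>(1 + 1 / real (Suc j)) ^ n\<rceil>) / real (nat \<lceil>(1 + 1 / real (Suc j)) ^ n\<rceil>)) \<longlonglongrightarrow> \<mu>"
  shows "(\<lambda>n. S n / real n) \<longlonglongrightarrow> \<mu>"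
proof -
  define \<alpha> where "\<alpha> j = 1 + 1 / real (Suc j)" for j
  have \<alpha>: "\<alpha> j > 1" for j by (simp add: \<alpha>_def)
  have \<alpha>n: "\<alpha> j ^ n \<ge> 1" for j n using \<alpha>[of j] by (simp add: one_le_power)
  define k where "k j n = nat \<lceil>\<alpha> j ^ n\<rceil>" for j n
  have k: "\<alpha> j ^ n \<le> real (k j n)" "real (k j n) \<le> \<alpha> j ^ n + 1" "k j n > 0" for j n
    using \<alpha>n[of j n] unfolding k_def by linarith+
  define q where "q j n = S (k j n) / real (k j n)" for j n
  have q: "(\<lambda>n. q j n) \<longlonglongrightarrow> \<mu>" for j using lim[of j] by (simp add: q_def k_def \<alpha>_def)
  have q_nonneg: "0 \<le> q j n" for j n by (simp add: q_def nonneg)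
  \<comment> \<open>The quotient of consecutive grid points exceeds \<open>\<alpha> j\<close> only
    through rounding: the ceiling adds at most 1, and 1 is \<open>inverse (\<alpha> j) ^ n\<close>
    times \<open>\<alpha> j ^ n\<close>.\<close>
  define \<rho> where "\<rho> j n = \<alpha> j + inverse (\<alpha> j) ^ n" for j n
  have \<rho>pos: "\<rho> j n > 0" for j n using \<alpha>[of j] by (auto simp: \<rho>_def intro!: add_pos_pos)
  have \<rho>: "(\<lambda>n. \<rho> j n) \<longlonglongrightarrow> \<alpha> j" for j
  proof -
    have "(\<lambda>n. \<alpha> j + inverse (\<alpha> j) ^ n) \<longlonglongrightarrow> \<alpha> j + 0"
      using \<alpha>[of j] by (intro tendsto_intros LIMSEQ_realpow_zero) (auto simp: inverse_less_1_iff)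
    then show ?thesis by (simp add: \<rho>_def)
  qed
  have ratio: "real (k j (Suc n)) \<le> \<rho> j n * real (k j n)" for j n
  proof -
    have "real (k j (Suc n)) \<le> \<alpha> j * \<alpha> j ^ n + 1" using k(2)[of j "Suc n"] by simp
    also have "\<dots> = \<rho> j n * \<alpha> j ^ n"
      using \<alpha>[of j] by (simp add: \<rho>_def distrib_right power_inverse)
    also have "\<dots> \<le> \<rho> j n * real (k j n)" using k(1) \<rho>pos[of j n] by (intro mult_left_mono) auto
    finally show ?thesis .
  qed
  \<comment> \<open>The logarithm locates N between the powers with exponents \<open>l j N\<close>
    and \<open>Suc (l j N)\<close>. Rounding the lower power up does not overshoot N because N is an
    integer.\<close>
  define l where "l j N = nat \<lfloor>log (\<alpha> j) (real N)\<rfloor>" for j N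
  have l: "filterlim (l j) at_top sequentially" for j
    unfolding l_def using \<alpha>[of j] by real_asymp
  have lk: "k j (l j N) \<le> N" "N \<le> k j (Suc (l j N))" if "N > 0" for j N
  proof -
    let ?x = "log (\<alpha> j) (real N)"
    have x: "?x \<ge> 0" using that \<alpha>[of j] by simp
    then have "real (l j N) \<le> ?x" "?x \<le> real (Suc (l j N))" unfolding l_def by linarith+
    then have "\<alpha> j powr real (l j N) \<le> \<alpha> j powr ?x" "\<alpha> j powr ?x \<le> \<alpha> j powr real (Suc (l j N))"
      using \<alpha>[of j] by (auto intro!: powr_mono)
    moreover have "\<alpha> j powr ?x = real N" using \<alpha>[of j] that by simp
    ultimately have *: "\<alpha> j ^ l j N \<le> real N" "real N \<le> \<alpha> j ^ Suc (l j N)"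
      using \<alpha>[of j] by (simp_all add: powr_realpow del: of_nat_Suc power_Suc)
    show "k j (l j N) \<le> N" using *(1) unfolding k_def by (simp add: nat_le_iff ceiling_le_iff)
    show "N \<le> k j (Suc (l j N))" using *(2) k(1)[of j "Suc (l j N)"] by linarith
  qed
  have upper: "S N / real N \<le> q j (Suc (l j N)) * \<rho> j (l j N)" if N: "N > 0" for j N
  proof -
    let ?n = "l j N"
    have "S N / real N \<le> S (k j (Suc ?n)) / real (k j ?n)"
      using lk[OF N, of j] k(3)[of j ?n] nonneg monoD[OF mono] by (intro frac_le) auto
    also have "\<dots> = q j (Suc ?n) * (real (k j (Suc ?n)) / real (k j ?n))"
      using k(3)[of j "Suc ?n"] by (simp add: q_def)
    also have "\<dots> \<le> q j (Suc ?n) * \<rho> j ?n"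
      using ratio[of j ?n] k(3)[of j ?n] by (intro mult_left_mono q_nonneg) (simp add: divide_le_eq)
    finally show ?thesis .
  qed
  have lower: "q j (l j N) / \<rho> j (l j N) \<le> S N / real N" if N: "N > 0" for j N
  proof -
    let ?n = "l j N"
    have "q j ?n / \<rho> j ?n = S (k j ?n) / (\<rho> j ?n * real (k j ?n))" by (simp add: q_def)
    also have "\<dots> \<le> S (k j ?n) / real (k j (Suc ?n))"
      using ratio[of j ?n] k(3)[of j "Suc ?n"] k(3)[of j ?n] \<rho>pos[of j ?n] by (intro divide_left_mono nonneg) auto
    also have "\<dots> \<le> S N / real N"
      using lk[OF N, of j] N nonneg monoD[OF mono] by (intro frac_le) auto
    finally show ?thesis .
  qed
  have \<alpha>1: "\<alpha> \<longlonglongrightarrow> 1" unfolding \<alpha>_def by real_asymp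
  show ?thesis
  proof (rule order_tendstoI)
    fix u assume u: "\<mu> < u"
    \<comment> \<open>First the ratio is chosen so close to 1 that the distorted limit stays below
      u; only then does N grow with this grid fixed.\<close>
    have "(\<lambda>j. \<mu> * \<alpha> j) \<longlonglongrightarrow> \<mu> * 1" by (intro tendsto_intros \<alpha>1)
    then have "eventually (\<lambda>j. \<mu> * \<alpha> j < u) sequentially" using u by (auto dest: order_tendstoD)
    then obtain j where j: "\<mu> * \<alpha> j < u" by (auto simp: eventually_sequentially)
    have "(\<lambda>n. q j (Suc n) * \<rho> j n) \<longlonglongrightarrow> \<mu> * \<alpha> j"
      by (intro tendsto_mult \<rho> filterlim_compose[OF q filterlim_Suc])
    then have "(\<lambda>N. q j (Suc (l j N)) * \<rho> j (l j N)) \<longlonglongrightarrow> \<mu> * \<alpha> j"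
      using l by (rule filterlim_compose)
    then have "eventually (\<lambda>N. q j (Suc (l j N)) * \<rho> j (l j N) < u) sequentially"
      using j by (auto dest: order_tendstoD)
    then show "eventually (\<lambda>N. S N / real N < u) sequentially"
      using eventually_gt_at_top[of 0] by eventually_elim (use upper in \<open>blast intro: le_less_trans\<close>)
  next
    fix u assume u: "u < \<mu>"
    have "(\<lambda>j. \<mu> / \<alpha> j) \<longlonglongrightarrow> \<mu> / 1" by (intro tendsto_intros \<alpha>1) simp
    then have "eventually (\<lambda>j. u < \<mu> / \<alpha> j) sequentially" using u by (auto dest: order_tendstoD)
    then obtain j where j: "u < \<mu> / \<alpha> j" by (auto simp: eventually_sequentially)
    have "(\<lambda>n. q j n / \<rho> j n) \<longlonglongrightarrow> \<mu> / \<alpha> j"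
      using \<alpha>[of j] by (intro tendsto_divide \<rho> q) auto
    then have "(\<lambda>N. q j (l j N) / \<rho> j (l j N)) \<longlonglongrightarrow> \<mu> / \<alpha> j"
      using l by (rule filterlim_compose)
    then have "eventually (\<lambda>N. u < q j (l j N) / \<rho> j (l j N)) sequentially"
      using j by (auto dest: order_tendstoD)
    then show "eventually (\<lambda>N. u < S N / real N) sequentially"
      using eventually_gt_at_top[of 0] by eventually_elim (use lower in \<open>blast intro: less_le_trans\<close>)
  qed
qed

text \<open>Nonnegativity makes the partial sums monotone, which is what allows the passage from
  geometric subsequences to all n.\<close>

lemma (in prob_space) strong_law_nonneg:
  fixes X :: "nat \<Rightarrow> 'a \<Rightarrow> real"
  assumes indep: "\<And>i j. i \<noteq> j \<Longrightarrow> indep_var borel (X i) borel (X j)"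
    and distr: "\<And>i. distr M borel (X i) = distr M borel (X 0)"
    and int: "integrable M (X 0)"
    and nonneg: "\<And>i \<omega>. \<omega> \<in> space M \<Longrightarrow> 0 \<le> X i \<omega>"
  shows "AE \<omega> in M. (\<lambda>n. (\<Sum>i<n. X i \<omega>) / real n) \<longlonglongrightarrow> expectation (X 0)"
proof -
  have "AE \<omega> in M. \<forall>j. (\<lambda>n. (\<Sum>i<nat \<lceil>(1 + 1 / real (Suc j)) ^ n\<rceil>. X i \<omega>) /
      real (nat \<lceil>(1 + 1 / real (Suc j)) ^ n\<rceil>)) \<longlonglongrightarrow> expectation (X 0)"
    unfolding AE_all_countable
    by (intro allI AE_tendsto_average_geometric assms) auto
  then show ?thesis using AE_space
  proof eventually_elim
    case (elim \<omega>)
    show ?case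
    proof (rule tendsto_average_of_geometric)
      show "mono (\<lambda>n. \<Sum>i<n. X i \<omega>)"
        by (intro monoI sum_mono2) (use nonneg[OF elim(2)] in auto)
    qed (use nonneg[OF elim(2)] elim(1) in \<open>auto intro: sum_nonneg\<close>)
  qed
qed

text \<open>Positive and negative parts are measurable functions of the variables, so each family is
  again pairwise independent, identically distributed and integrable.\<close>

theorem (in prob_space) strong_law_of_large_numbers:
  fixes X :: "nat \<Rightarrow> 'a \<Rightarrow> real"
  assumes indep: "\<And>i j. i \<noteq> j \<Longrightarrow> indep_var borel (X i) borel (X j)"
    and distr: "\<And>i. distr M borel (X i) = distr M borel (X 0)"
    and int: "integrable M (X 0)"
  shows "AE \<omega> in M. (\<lambda>n. (\<Sum>i<n. X i \<omega>) / real n) \<longlonglongrightarrow> expectation (X 0)"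
proof -
  have meas[measurable]: "random_variable borel (X i)" for i
    by (rule indep_var_rv1[OF indep[of i "Suc i"]]) simp
  have part: "AE \<omega> in M. (\<lambda>n. (\<Sum>i<n. f (X i \<omega>)) / real n) \<longlonglongrightarrow> expectation (\<lambda>\<omega>. f (X 0 \<omega>))"
    if f[measurable]: "f \<in> borel_measurable borel" and "\<And>y. 0 \<le> f y" "\<And>y. f y \<le> \<bar>y\<bar>" for f :: "real \<Rightarrow> real"
  proof (rule strong_law_nonneg)
    show "indep_var borel (\<lambda>\<omega>. f (X i \<omega>)) borel (\<lambda>\<omega>. f (X j \<omega>))" if "i \<noteq> j" for i j
      using indep_var_compose[OF indep[OF that] f f] by (simp add: comp_def)
    have "distr M borel (\<lambda>\<omega>. f (X i \<omega>)) = distr (distr M borel (X i)) borel f" for i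
      by (subst distr_distr) (auto simp: comp_def)
    then show "distr M borel (\<lambda>\<omega>. f (X i \<omega>)) = distr M borel (\<lambda>\<omega>. f (X 0 \<omega>))" for i
      using distr[of i] by simp
    show "integrable M (\<lambda>\<omega>. f (X 0 \<omega>))"
      by (rule Bochner_Integration.integrable_bound[OF int]) (use that in auto)
  qed (use that in auto)
  have int_parts: "integrable M (\<lambda>\<omega>. max 0 (X 0 \<omega>))" "integrable M (\<lambda>\<omega>. max 0 (- X 0 \<omega>))"
    by (rule Bochner_Integration.integrable_bound[OF int]; auto)+
  have "X i \<omega> = max 0 (X i \<omega>) - max 0 (- X i \<omega>)" for i \<omega> by auto
  then have sum_eq: "(\<Sum>i<n. X i \<omega>) = (\<Sum>i<n. max 0 (X i \<omega>)) - (\<Sum>i<n. max 0 (- X i \<omega>))" for n \<omega>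
    by (metis (mono_tags, lifting) sum.cong sum_subtractf)
  have exp_eq: "expectation (X 0) = expectation (\<lambda>\<omega>. max 0 (X 0 \<omega>)) - expectation (\<lambda>\<omega>. max 0 (- X 0 \<omega>))"
    unfolding Bochner_Integration.integral_diff[OF int_parts, symmetric]
    by (rule Bochner_Integration.integral_cong) auto
  have "AE \<omega> in M. (\<lambda>n. (\<Sum>i<n. max 0 (X i \<omega>)) / real n) \<longlonglongrightarrow> expectation (\<lambda>\<omega>. max 0 (X 0 \<omega>))"
    "AE \<omega> in M. (\<lambda>n. (\<Sum>i<n. max 0 (- X i \<omega>)) / real n) \<longlonglongrightarrow> expectation (\<lambda>\<omega>. max 0 (- X 0 \<omega>))"
    by (rule part; auto)+
  then show ?thesis
  proof eventually_elim
    case (elim \<omega>)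
    from tendsto_diff[OF this] show ?case by (simp add: sum_eq exp_eq diff_divide_distrib)
  qed
qed

section \<open>Conditionally subgaussian noise\<close>

text \<open>The weight is moved through the conditional expectation in the extended nonnegative
  setting, where no integrability has to be known beforehand; the finite bound then yields
  integrability.\<close>

lemma (in prob_space)
  fixes Z \<eta> :: "'a \<Rightarrow> real"
  assumes sub: "subalgebra M F" and \<eta>[measurable]: "\<eta> \<in> borel_measurable M"
    and sg: "cond_subgaussian M F \<sigma> \<eta>"
    and ZF: "Z \<in> borel_measurable F" and nonneg: "\<And>\<omega>. 0 \<le> Z \<omega>" and int: "integrable M Z"
  shows cond_subgaussian_integrable_exp: "integrable M (\<lambda>\<omega>. Z \<omega> * exp (t * \<eta> \<omega>))"
    and cond_subgaussian_integral_exp_le: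
      "expectation (\<lambda>\<omega>. Z \<omega> * exp (t * \<eta> \<omega>)) \<le> exp (t\<^sup>2 * \<sigma>\<^sup>2 / 2) * expectation Z"
proof -
  interpret finite_measure_subalgebra M F by unfold_locales (rule sub)
  have [measurable]: "Z \<in> borel_measurable M" using int by simp
  have "(\<integral>\<^sup>+\<omega>. ennreal (Z \<omega> * exp (t * \<eta> \<omega>)) \<partial>M) = (\<integral>\<^sup>+\<omega>. ennreal (Z \<omega>) * ennreal (exp (t * \<eta> \<omega>)) \<partial>M)"
    by (simp add: ennreal_mult nonneg)
  also have "\<dots> = (\<integral>\<^sup>+\<omega>. ennreal (Z \<omega>) * nn_cond_exp M F (\<lambda>\<omega>'. ennreal (exp (t * \<eta> \<omega>'))) \<omega> \<partial>M)"
    by (rule nn_cond_exp_intg[symmetric]) (use ZF in measurable)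
  also have "\<dots> \<le> (\<integral>\<^sup>+\<omega>. ennreal (Z \<omega>) * ennreal (exp (t\<^sup>2 * \<sigma>\<^sup>2 / 2)) \<partial>M)"
    using sg[unfolded cond_subgaussian_def, rule_format, of t]
    by (intro nn_integral_mono_AE) (auto elim!: eventually_mono intro!: mult_left_mono)
  also have "\<dots> = ennreal (expectation Z) * ennreal (exp (t\<^sup>2 * \<sigma>\<^sup>2 / 2))"
    by (subst nn_integral_multc) (auto simp: nn_integral_eq_integral int nonneg)
  also have "\<dots> = ennreal (exp (t\<^sup>2 * \<sigma>\<^sup>2 / 2) * expectation Z)"
    by (simp add: ennreal_mult' nonneg mult.commute)
  finally have le: "(\<integral>\<^sup>+\<omega>. ennreal (Z \<omega> * exp (t * \<eta> \<omega>)) \<partial>M) \<le> ennreal (exp (t\<^sup>2 * \<sigma>\<^sup>2 / 2) * expectation Z)" .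
  show 1: "integrable M (\<lambda>\<omega>. Z \<omega> * exp (t * \<eta> \<omega>))"
    by (rule integrableI_nonneg) (use le nonneg in \<open>auto intro: le_less_trans\<close>)
  show "expectation (\<lambda>\<omega>. Z \<omega> * exp (t * \<eta> \<omega>)) \<le> exp (t\<^sup>2 * \<sigma>\<^sup>2 / 2) * expectation Z"
    using le nn_integral_eq_integral[OF 1] nonneg by (simp add: ennreal_le_iff)
qed

text \<open>The quadratic Taylor bound of exp at \<bar>y\<bar> gives y^2 \<le> 2 (exp y + exp (-y)),
  so the exponential moments at t = 1 and t = -1 suffice. The constant is not sharp; only its
  independence of the sample index matters later.\<close>

lemma (in prob_space)
  fixes Z \<eta> :: "'a \<Rightarrow> real"
  assumes sub: "subalgebra M F" and \<eta>[measurable]: "\<eta> \<in> borel_measurable M"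
    and sg: "cond_subgaussian M F \<sigma> \<eta>"
    and ZF: "Z \<in> borel_measurable F" and nonneg: "\<And>\<omega>. 0 \<le> Z \<omega>" and int: "integrable M Z"
  shows cond_subgaussian_integrable_square: "integrable M (\<lambda>\<omega>. Z \<omega> * (\<eta> \<omega>)\<^sup>2)"
    and cond_subgaussian_integral_square_le:
      "expectation (\<lambda>\<omega>. Z \<omega> * (\<eta> \<omega>)\<^sup>2) \<le> 4 * exp (\<sigma>\<^sup>2 / 2) * expectation Z"
proof -
  have [measurable]: "Z \<in> borel_measurable M" using int by simp
  have ie: "integrable M (\<lambda>\<omega>. Z \<omega> * exp (t * \<eta> \<omega>))" for t
    by (rule cond_subgaussian_integrable_exp[OF sub \<eta> sg ZF nonneg int])
  have le: "expectation (\<lambda>\<omega>. Z \<omega> * exp (t * \<eta> \<omega>)) \<le> exp (t\<^sup>2 * \<sigma>\<^sup>2 / 2) * expectation Z" for t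
    by (rule cond_subgaussian_integral_exp_le[OF sub \<eta> sg ZF nonneg int])
  have sq: "y\<^sup>2 \<le> 2 * (exp y + exp (- y))" for y :: real
  proof -
    have "\<bar>y\<bar>\<^sup>2 \<le> 2 * exp \<bar>y\<bar>" using exp_lower_Taylor_quadratic[of "\<bar>y\<bar>"] by simp
    also have "exp \<bar>y\<bar> \<le> exp y + exp (- y)" by (cases "y \<ge> 0") auto
    finally show ?thesis by simp
  qed
  have bnd: "Z \<omega> * (\<eta> \<omega>)\<^sup>2 \<le> 2 * (Z \<omega> * exp (1 * \<eta> \<omega>) + Z \<omega> * exp (- 1 * \<eta> \<omega>))" for \<omega>
    using mult_left_mono[OF sq[of "\<eta> \<omega>"] nonneg[of \<omega>]] by (simp add: algebra_simps)
  show "integrable M (\<lambda>\<omega>. Z \<omega> * (\<eta> \<omega>)\<^sup>2)"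
  proof (rule Bochner_Integration.integrable_bound)
    show "integrable M (\<lambda>\<omega>. 2 * (Z \<omega> * exp (1 * \<eta> \<omega>) + Z \<omega> * exp (- 1 * \<eta> \<omega>)))"
      using ie[of 1] ie[of "- 1"] by simp
    show "AE \<omega> in M. norm (Z \<omega> * (\<eta> \<omega>)\<^sup>2)
        \<le> norm (2 * (Z \<omega> * exp (1 * \<eta> \<omega>) + Z \<omega> * exp (- 1 * \<eta> \<omega>)))"
    proof (rule AE_I2)
      fix \<omega>
      have "norm (Z \<omega> * (\<eta> \<omega>)\<^sup>2) = Z \<omega> * (\<eta> \<omega>)\<^sup>2" using nonneg by simp
      then show "norm (Z \<omega> * (\<eta> \<omega>)\<^sup>2)
          \<le> norm (2 * (Z \<omega> * exp (1 * \<eta> \<omega>) + Z \<omega> * exp (- 1 * \<eta> \<omega>)))"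
        using bnd[of \<omega>] by (metis abs_ge_self order_trans real_norm_def)
    qed
  qed measurable
  then have "expectation (\<lambda>\<omega>. Z \<omega> * (\<eta> \<omega>)\<^sup>2) \<le> expectation (\<lambda>\<omega>. 2 * (Z \<omega> * exp (1 * \<eta> \<omega>) + Z \<omega> * exp (- 1 * \<eta> \<omega>)))"
    by (rule integral_mono) (use ie[of 1] ie[of "- 1"] bnd in auto)
  also have "\<dots> \<le> 4 * exp (\<sigma>\<^sup>2 / 2) * expectation Z"
    unfolding integral_mult_right_zero Bochner_Integration.integral_add[OF ie[of 1] ie[of "- 1"]]
    using le[of 1] le[of "- 1"] by simp
  finally show "expectation (\<lambda>\<omega>. Z \<omega> * (\<eta> \<omega>)\<^sup>2) \<le> 4 * exp (\<sigma>\<^sup>2 / 2) * expectation Z" .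
qed

text \<open>In effect the conditional mean of the noise given \<open>F\<close> is 0, expressed
  through \<open>F\<close>-measurable test functions. The two signs of t are what exclude a drift in
  either direction.\<close>

lemma (in prob_space)
  fixes Z \<eta> :: "'a \<Rightarrow> real"
  assumes sub: "subalgebra M F" and \<eta>[measurable]: "\<eta> \<in> borel_measurable M"
    and sg: "cond_subgaussian M F \<sigma> \<eta>"
    and ZF: "Z \<in> borel_measurable F" and int: "integrable M Z"
  shows cond_subgaussian_integrable: "integrable M (\<lambda>\<omega>. Z \<omega> * \<eta> \<omega>)"
    and cond_subgaussian_integral_eq_0: "expectation (\<lambda>\<omega>. Z \<omega> * \<eta> \<omega>) = 0"
proof -
  have nonneg_case: "integrable M (\<lambda>\<omega>. Z \<omega> * \<eta> \<omega>) \<and> expectation (\<lambda>\<omega>. Z \<omega> * \<eta> \<omega>) = 0"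
    if ZF: "Z \<in> borel_measurable F" and int: "integrable M Z" and nonneg: "\<And>\<omega>. 0 \<le> Z \<omega>" for Z
  proof
    have [measurable]: "Z \<in> borel_measurable M" using int by simp
    note sq = cond_subgaussian_integrable_square[OF sub \<eta> sg ZF nonneg int]
    show i: "integrable M (\<lambda>\<omega>. Z \<omega> * \<eta> \<omega>)"
    proof (rule Bochner_Integration.integrable_bound)
      show "integrable M (\<lambda>\<omega>. Z \<omega> + Z \<omega> * (\<eta> \<omega>)\<^sup>2)" using int sq by simp
      show "AE \<omega> in M. norm (Z \<omega> * \<eta> \<omega>) \<le> norm (Z \<omega> + Z \<omega> * (\<eta> \<omega>)\<^sup>2)"
      proof (rule AE_I2)
        fix \<omega>
        have "\<bar>\<eta> \<omega>\<bar> \<le> 1 + (\<eta> \<omega>)\<^sup>2"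
          using sum_squares_bound[of 1 "\<bar>\<eta> \<omega>\<bar>"] by simp
        from mult_left_mono[OF this nonneg[of \<omega>]]
        have "norm (Z \<omega> * \<eta> \<omega>) \<le> Z \<omega> + Z \<omega> * (\<eta> \<omega>)\<^sup>2"
          using nonneg[of \<omega>] by (simp add: abs_mult distrib_left)
        then show "norm (Z \<omega> * \<eta> \<omega>) \<le> norm (Z \<omega> + Z \<omega> * (\<eta> \<omega>)\<^sup>2)"
          by (metis abs_ge_self order_trans real_norm_def)
      qed
    qed measurable
    define A where "A = expectation (\<lambda>\<omega>. Z \<omega> * \<eta> \<omega>)"
    \<comment> \<open>h is nonnegative and vanishes at 0, so its derivative \<open>- A\<close> there is 0.\<close>
    define h where "h t = exp (t\<^sup>2 * \<sigma>\<^sup>2 / 2) * expectation Z - expectation Z - t * A" for t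
    have h_nonneg: "0 \<le> h t" for t
    proof -
      have "expectation Z + t * A = expectation (\<lambda>\<omega>. Z \<omega> + t * (Z \<omega> * \<eta> \<omega>))"
        using int i by (simp add: A_def)
      also have "\<dots> \<le> expectation (\<lambda>\<omega>. Z \<omega> * exp (t * \<eta> \<omega>))"
      proof (rule integral_mono)
        fix \<omega>
        show "Z \<omega> + t * (Z \<omega> * \<eta> \<omega>) \<le> Z \<omega> * exp (t * \<eta> \<omega>)"
          using mult_left_mono[OF exp_ge_add_one_self[of "t * \<eta> \<omega>"] nonneg[of \<omega>]]
          by (simp add: algebra_simps)
      qed (use int i cond_subgaussian_integrable_exp[OF sub \<eta> sg ZF nonneg int] in auto)
      also have "\<dots> \<le> exp (t\<^sup>2 * \<sigma>\<^sup>2 / 2) * expectation Z"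
        by (rule cond_subgaussian_integral_exp_le[OF sub \<eta> sg ZF nonneg int])
      finally show ?thesis by (simp add: h_def)
    qed
    have "(h has_real_derivative - A) (at 0)"
      unfolding h_def by (auto intro!: derivative_eq_intros)
    then have "- A = 0"
      by (rule DERIV_local_min[of _ _ _ 1]) (use h_nonneg in \<open>auto simp: h_def\<close>)
    then show "expectation (\<lambda>\<omega>. Z \<omega> * \<eta> \<omega>) = 0" by (simp add: A_def)
  qed
  \<comment> \<open>The exponential inequality can be multiplied only by nonnegative weights, so a
    signed weight is split into its two parts.\<close>
  have pos: "integrable M (\<lambda>\<omega>. max 0 (Z \<omega>) * \<eta> \<omega>) \<and> expectation (\<lambda>\<omega>. max 0 (Z \<omega>) * \<eta> \<omega>) = 0"
    and neg: "integrable M (\<lambda>\<omega>. max 0 (- Z \<omega>) * \<eta> \<omega>) \<and> expectation (\<lambda>\<omega>. max 0 (- Z \<omega>) * \<eta> \<omega>) = 0"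
    by (rule nonneg_case; use ZF int in \<open>auto intro!: integrable_max\<close>)+
  have eq: "(\<lambda>\<omega>. Z \<omega> * \<eta> \<omega>) = (\<lambda>\<omega>. max 0 (Z \<omega>) * \<eta> \<omega> - max 0 (- Z \<omega>) * \<eta> \<omega>)"
    by (auto simp: max_def)
  show "integrable M (\<lambda>\<omega>. Z \<omega> * \<eta> \<omega>)" "expectation (\<lambda>\<omega>. Z \<omega> * \<eta> \<omega>) = 0"
    unfolding eq using pos neg by auto
qed

text \<open>For j < i the history before the i-th noise contains the whole j-th term and the current
  context and action. Hence the product of the j-th term with the i-th weight is an admissible test
  function for the i-th noise, and distinct terms are orthogonal. Testing the squared noise against
  the squared weight bounds the variances uniformly.\<close>

lemma (in prob_space) AE_noise_average_tendsto_0: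
  fixes x :: "nat \<Rightarrow> 'a \<Rightarrow> ('v :: euclidean_space)" and z :: "'v \<times> nat \<Rightarrow> real"
  assumes xa: "\<And>i. i \<ge> 1 \<Longrightarrow> (\<lambda>\<omega>. (x i \<omega>, act i \<omega>)) \<in> measurable M (borel \<Otimes>\<^sub>M count_space {1..K})"
    and \<eta>: "\<And>i. i \<ge> 1 \<Longrightarrow> \<eta> i \<in> borel_measurable M"
    and sg: "\<And>i. i \<ge> 1 \<Longrightarrow> cond_subgaussian M (history M K x act \<eta> i) \<sigma> (\<eta> i)"
    and z[measurable]: "z \<in> borel_measurable (borel \<Otimes>\<^sub>M count_space {1..K})"
    and z_int: "\<And>i. i \<ge> 1 \<Longrightarrow> integrable M (\<lambda>\<omega>. (z (x i \<omega>, act i \<omega>))\<^sup>2)"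
    and z_bound: "\<And>i. i \<ge> 1 \<Longrightarrow> expectation (\<lambda>\<omega>. (z (x i \<omega>, act i \<omega>))\<^sup>2) \<le> C"
  shows "AE \<omega> in M. (\<lambda>n. (\<Sum>i<n. z (x (Suc i) \<omega>, act (Suc i) \<omega>) * \<eta> (Suc i) \<omega>) / real n) \<longlonglongrightarrow> 0"
proof -
  define H where "H i = history M K x act \<eta> i" for i
  define Y where "Y i \<omega> = z (x i \<omega>, act i \<omega>) * \<eta> i \<omega>" for i \<omega>
  have x: "x i \<in> borel_measurable M" and act: "act i \<in> measurable M (count_space {1..K})" if "i \<ge> 1" for i
    using measurable_compose[OF xa[OF that] measurable_fst] measurable_compose[OF xa[OF that] measurable_snd]
    by simp_all
  have sub: "subalgebra M (H i)" if "i \<ge> 1" for i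
    unfolding H_def by (rule subalgebra_history) (use x act \<eta> that in auto)
  have past_M: "(\<lambda>\<omega>. (x j \<omega>, act j \<omega>, \<eta> j \<omega>)) \<in> measurable M (borel \<Otimes>\<^sub>M count_space {1..K} \<Otimes>\<^sub>M borel)"
    if "j \<ge> 1" for j
    using that by (intro measurable_Pair x act \<eta>)
  \<comment> \<open>The history is by construction the smallest \<sigma>-algebra making this map
    measurable; past terms and the current weight are then measurable as functions of its
    components.\<close>
  have h: "(\<lambda>\<omega>. (\<lambda>j\<in>{1..<i}. (x j \<omega>, act j \<omega>, \<eta> j \<omega>), (x i \<omega>, act i \<omega>))) \<in> measurable (H i)
      ((\<Pi>\<^sub>M j\<in>{1..<i}. borel \<Otimes>\<^sub>M count_space {1..K} \<Otimes>\<^sub>M borel) \<Otimes>\<^sub>M (borel \<Otimes>\<^sub>M count_space {1..K}))"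
    (is "?h \<in> measurable _ ?N") if "i \<ge> 1" for i
  proof -
    have "?h \<in> measurable M ?N"
      using that by (intro measurable_Pair[OF measurable_restrict] past_M xa) auto
    then show ?thesis
      unfolding H_def history_def by (intro measurable_vimage_algebra1) (auto dest: measurable_space)
  qed
  have cur: "(\<lambda>\<omega>. z (x i \<omega>, act i \<omega>)) \<in> borel_measurable (H i)" if "i \<ge> 1" for i
    using measurable_compose[OF measurable_compose[OF h[OF that] measurable_snd] z] by simp
  have past: "Y j \<in> borel_measurable (H i)" if j: "1 \<le> j" "j < i" for i j
  proof -
    have ji: "j \<in> {1..<i}" and i: "i \<ge> 1" using j by auto
    have "(\<lambda>\<omega>. (x j \<omega>, act j \<omega>, \<eta> j \<omega>)) \<in> measurable (H i) (borel \<Otimes>\<^sub>M count_space {1..K} \<Otimes>\<^sub>M borel)"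
      using measurable_compose[OF measurable_compose[OF h[OF i] measurable_fst] measurable_component_singleton[OF ji]] j
      by simp
    then have "(\<lambda>\<omega>. (\<lambda>(v, b, e). z (v, b) * e) (x j \<omega>, act j \<omega>, \<eta> j \<omega>)) \<in> borel_measurable (H i)"
      by (rule measurable_compose) measurable
    then show ?thesis by (simp add: Y_def[abs_def])
  qed
  have Y_meas: "Y i \<in> borel_measurable M" if "i \<ge> 1" for i
    unfolding Y_def using measurable_compose[OF xa[OF that] z] \<eta>[OF that] by (intro borel_measurable_times)
  have sqF: "(\<lambda>\<omega>. (z (x i \<omega>, act i \<omega>))\<^sup>2) \<in> borel_measurable (H i)" if "i \<ge> 1" for i
    using cur[OF that] by measurable
  have Y_sq: "integrable M (\<lambda>\<omega>. (Y i \<omega>)\<^sup>2)" if "i \<ge> 1" for i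
    using cond_subgaussian_integrable_square[OF sub[OF that] \<eta>[OF that] sg[OF that, folded H_def] sqF[OF that] _ z_int[OF that]]
    by (simp add: Y_def power_mult_distrib)
  have Y_bound: "expectation (\<lambda>\<omega>. (Y i \<omega>)\<^sup>2) \<le> 4 * exp (\<sigma>\<^sup>2 / 2) * C" if "i \<ge> 1" for i
  proof -
    have "expectation (\<lambda>\<omega>. (Y i \<omega>)\<^sup>2) \<le> 4 * exp (\<sigma>\<^sup>2 / 2) * expectation (\<lambda>\<omega>. (z (x i \<omega>, act i \<omega>))\<^sup>2)"
      using cond_subgaussian_integral_square_le[OF sub[OF that] \<eta>[OF that] sg[OF that, folded H_def] sqF[OF that] _ z_int[OF that]]
      by (simp add: Y_def power_mult_distrib)
    also have "\<dots> \<le> 4 * exp (\<sigma>\<^sup>2 / 2) * C" using z_bound[OF that] by (intro mult_left_mono) auto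
    finally show ?thesis .
  qed
  have orth_less: "expectation (\<lambda>\<omega>. Y j \<omega> * Y i \<omega>) = 0" if j: "1 \<le> j" "j < i" for i j
  proof -
    have i: "i \<ge> 1" using j by auto
    have "expectation (\<lambda>\<omega>. (Y j \<omega> * z (x i \<omega>, act i \<omega>)) * \<eta> i \<omega>) = 0"
    proof (rule cond_subgaussian_integral_eq_0[OF sub[OF i] \<eta>[OF i] sg[OF i, folded H_def]])
      show "(\<lambda>\<omega>. Y j \<omega> * z (x i \<omega>, act i \<omega>)) \<in> borel_measurable (H i)"
        by (intro borel_measurable_times past[OF j] cur[OF i])
      \<comment> \<open>Two square integrable factors: the earlier term by the subgaussian second
        moment bound, the current weight by hypothesis.\<close>
      show "integrable M (\<lambda>\<omega>. Y j \<omega> * z (x i \<omega>, act i \<omega>))"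
        by (rule integrable_mult_of_square_integrable[OF Y_meas[OF j(1)] measurable_compose[OF xa[OF i] z]
              Y_sq[OF j(1)] z_int[OF i]])
    qed
    then show ?thesis by (simp add: Y_def mult_ac)
  qed
  \<comment> \<open>Samples are numbered from 1 while the law for orthogonal variables sums from 0,
    hence the shift by \<open>Suc\<close>.\<close>
  have "expectation (\<lambda>\<omega>. Y (Suc i) \<omega> * Y (Suc j) \<omega>) = 0" if "i \<noteq> j" for i j
    using orth_less[of "Suc i" "Suc j"] orth_less[of "Suc j" "Suc i"] that
    by (cases "i < j") (auto simp: mult.commute)
  from strong_law_orthogonal[of "\<lambda>i. Y (Suc i)", OF Y_meas Y_sq this Y_bound]
  show ?thesis by (simp add: Y_def)
qed

section \<open>Least squares\<close>

lemma tendsto_det: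
  fixes A :: "'a \<Rightarrow> real ^ 'n ^ 'n"
  assumes "\<And>i j. ((\<lambda>n. A n $ i $ j) \<longlongrightarrow> L $ i $ j) F"
  shows "((\<lambda>n. det (A n)) \<longlongrightarrow> det L) F"
  unfolding det_def by (intro tendsto_intros assms)

lemma matrix_inv_inverse:
  fixes A :: "real ^ 'n ^ 'm"
  assumes "invertible A"
  shows "A ** matrix_inv A = mat 1" "matrix_inv A ** A = mat 1"
  using someI_ex[OF assms[unfolded invertible_def]] by (simp_all add: matrix_inv_def)

lemma tendsto_matrix_inv_mult_vec:
  fixes A :: "nat \<Rightarrow> real ^ 'n ^ 'n" and b :: "nat \<Rightarrow> real ^ 'n"
  assumes A: "\<And>i j. (\<lambda>n. A n $ i $ j) \<longlonglongrightarrow> L $ i $ j"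
    and b: "\<And>i. (\<lambda>n. b n $ i) \<longlonglongrightarrow> c $ i" and L: "invertible L"
  shows "(\<lambda>n. matrix_inv (A n) *v b n) \<longlonglongrightarrow> matrix_inv L *v c"
proof -
  define sol where "sol B d = (\<chi> k. det (\<chi> i j. if j = k then d $ i else B $ i $ j) / det B)"
    for B :: "real ^ 'n ^ 'n" and d
  have sol: "matrix_inv B *v d = sol B d" if "det B \<noteq> 0" for B :: "real ^ 'n ^ 'n" and d
  proof -
    have "B *v (matrix_inv B *v d) = d"
      using that by (simp add: matrix_vector_mul_assoc matrix_inv_inverse invertible_det_nz)
    then show ?thesis unfolding cramer[OF that] sol_def .
  qed
  have detL: "det L \<noteq> 0" using L by (simp add: invertible_det_nz)
  have det: "(\<lambda>n. det (A n)) \<longlonglongrightarrow> det L" by (rule tendsto_det) (rule A)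
  \<comment> \<open>Finitely many of the matrices may be singular; there \<open>matrix_inv\<close>
    has an unspecified value, which does not affect the limit.\<close>
  then have "eventually (\<lambda>n. det (A n) \<noteq> 0) sequentially"
    using detL by (rule tendsto_imp_eventually_ne)
  then have ev: "eventually (\<lambda>n. sol (A n) (b n) = matrix_inv (A n) *v b n) sequentially"
    by eventually_elim (simp add: sol)
  have "(\<lambda>n. sol (A n) (b n)) \<longlonglongrightarrow> sol L c"
    unfolding sol_def
    by (intro tendsto_vec_lambda tendsto_divide det detL tendsto_det) (auto intro: A b)
  from Lim_transform_eventually[OF this ev] show ?thesis by (simp add: sol[OF detL])
qed

text \<open>The deterministic part, for one fixed sample path. Splitting the inner product in the
  reward into observed and hidden coordinates, the empirical moment vector tends to
  \<open>R *v obs w + S *v hid w\<close>: the hidden coordinates survive through their correlation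
  with the observed ones, and this is the source of the term with \<open>S\<close>.\<close>

lemma b_LS_tendsto:
  fixes a :: nat and x :: "nat \<Rightarrow> real ^ ('l :: finite + 'h :: finite)" and act :: "nat \<Rightarrow> nat" and \<eta> r :: "nat \<Rightarrow> real"
    and R :: "real ^ 'l ^ 'l" and S :: "real ^ 'h ^ 'l"
  defines "I k \<equiv> (indicator {a} (act k) :: real)"
  assumes r: "\<And>i. i \<ge> 1 \<Longrightarrow> act i = a \<Longrightarrow> r i = x i \<bullet> w + \<eta> i"
    and p: "p > 0" "(\<lambda>N. (\<Sum>k<N. I (Suc k)) / real N) \<longlonglongrightarrow> p"
    and R: "\<And>i j. (\<lambda>N. (\<Sum>k<N. I (Suc k) * (x (Suc k) $ Inl i * x (Suc k) $ Inl j)) / real N)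
        \<longlonglongrightarrow> p * R $ i $ j"
    and S: "\<And>i j. (\<lambda>N. (\<Sum>k<N. I (Suc k) * (x (Suc k) $ Inl i * x (Suc k) $ Inr j)) / real N)
        \<longlonglongrightarrow> p * S $ i $ j"
    and \<eta>: "\<And>i. (\<lambda>N. (\<Sum>k<N. I (Suc k) * x (Suc k) $ Inl i * \<eta> (Suc k)) / real N) \<longlonglongrightarrow> 0"
    and inv: "invertible R"
  shows "(\<lambda>N. b_LS (\<lambda>i. obs (x i)) act r N a) \<longlonglongrightarrow> block_row (mat 1) (matrix_inv R ** S) *v w"
proof -
  let ?J = "\<lambda>N. {i \<in> {1..N}. act i = a}"
  have sum_J: "(\<Sum>i\<in>?J N. f i) = (\<Sum>k<N. I (Suc k) * f (Suc k))" for f :: "nat \<Rightarrow> real" and N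
  proof -
    have "(\<Sum>i\<in>?J N. f i) = (\<Sum>i\<in>{1..N}. if act i = a then f i else 0)"
      by (rule sum.inter_filter) simp
    also have "\<dots> = (\<Sum>i\<in>{1..N}. I i * f i)"
      by (rule sum.cong) (auto simp: I_def)
    also have "\<dots> = (\<Sum>k<N. I (Suc k) * f (Suc k))"
      by (simp add: sum.atLeast1_atMost_eq)
    finally show ?thesis .
  qed
  have num: "real (num_chosen act N a) = (\<Sum>k<N. I (Suc k))" for N
    using sum_J[where f = "\<lambda>_. 1" and N = N] by (simp add: num_chosen_def)
  \<comment> \<open>An average over the samples with action \<open>a\<close> is a quotient of two
    averages over all samples, in which the factor p cancels.\<close>
  have ratio: "(\<lambda>N. 1 / real (num_chosen act N a) * (\<Sum>i\<in>?J N. f i)) \<longlonglongrightarrow> L"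
    if "(\<lambda>N. (\<Sum>k<N. I (Suc k) * f (Suc k)) / real N) \<longlonglongrightarrow> p * L" for f L
  proof -
    have "(\<lambda>N. ((\<Sum>k<N. I (Suc k) * f (Suc k)) / real N) / ((\<Sum>k<N. I (Suc k)) / real N))
        \<longlonglongrightarrow> p * L / p"
      using p by (intro tendsto_divide that) auto
    moreover have "eventually (\<lambda>N. ((\<Sum>k<N. I (Suc k) * f (Suc k)) / real N) / ((\<Sum>k<N. I (Suc k)) / real N)
        = 1 / real (num_chosen act N a) * (\<Sum>i\<in>?J N. f i)) sequentially"
      unfolding num sum_J using eventually_gt_at_top[of 0] by eventually_elim simp
    ultimately show ?thesis using p(1) by (auto dest: Lim_transform_eventually)
  qed
  have A_lim: "(\<lambda>N. ((1 / real (num_chosen act N a)) *\<^sub>R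
      (\<Sum>i\<in>?J N. outer (obs (x i)) (obs (x i)))) $ i $ j) \<longlonglongrightarrow> R $ i $ j" for i j
    using ratio[where f = "\<lambda>k. x k $ Inl i * x k $ Inl j", OF R] by (simp add: outer_def obs_def)
  have sum_split: "(\<Sum>l\<in>UNIV. f l) = (\<Sum>j\<in>UNIV. f (Inl j)) + (\<Sum>j\<in>UNIV. f (Inr j))"
    for f :: "'l + 'h \<Rightarrow> real"
    unfolding UNIV_Plus_UNIV[symmetric] by (subst sum.Plus) auto
  have b_lim: "(\<lambda>N. ((1 / real (num_chosen act N a)) *\<^sub>R (\<Sum>i\<in>?J N. r i *\<^sub>R obs (x i))) $ i)
      \<longlonglongrightarrow> (R *v obs w + S *v hid w) $ i" for i
  proof -
    let ?c = "\<lambda>l k. x k $ Inl i * x k $ l"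
    have rew: "I (Suc k) * (r (Suc k) * x (Suc k) $ Inl i) =
        (\<Sum>j\<in>UNIV. I (Suc k) * ?c (Inl j) (Suc k) * w $ Inl j)
        + (\<Sum>j\<in>UNIV. I (Suc k) * ?c (Inr j) (Suc k) * w $ Inr j)
        + I (Suc k) * x (Suc k) $ Inl i * \<eta> (Suc k)" for k
      by (cases "act (Suc k) = a")
        (simp_all add: I_def r inner_vec_def sum_split distrib_left distrib_right sum_distrib_left sum_distrib_right mult_ac)
    \<comment> \<open>Exchanging the sample sum with the finite coordinate sums leaves a fixed
      linear combination of averages whose limits are assumed.\<close>
    have "(\<Sum>k<N. I (Suc k) * (r (Suc k) * x (Suc k) $ Inl i)) / real N =
        (\<Sum>j\<in>UNIV. (\<Sum>k<N. I (Suc k) * ?c (Inl j) (Suc k)) / real N * w $ Inl j)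
        + (\<Sum>j\<in>UNIV. (\<Sum>k<N. I (Suc k) * ?c (Inr j) (Suc k)) / real N * w $ Inr j)
        + (\<Sum>k<N. I (Suc k) * x (Suc k) $ Inl i * \<eta> (Suc k)) / real N" for N
      unfolding rew sum.distrib add_divide_distrib
      by (subst (1 2) sum.swap) (simp add: sum_distrib_right sum_divide_distrib)
    then have "(\<lambda>N. (\<Sum>k<N. I (Suc k) * (r (Suc k) * x (Suc k) $ Inl i)) / real N) \<longlonglongrightarrow>
        (\<Sum>j\<in>UNIV. p * R $ i $ j * w $ Inl j) + (\<Sum>j\<in>UNIV. p * S $ i $ j * w $ Inr j) + 0"
      by (simp only:) (intro tendsto_intros R S \<eta>)
    also have "(\<Sum>j\<in>UNIV. p * R $ i $ j * w $ Inl j) + (\<Sum>j\<in>UNIV. p * S $ i $ j * w $ Inr j) + 0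
        = p * (R *v obs w + S *v hid w) $ i"
      by (simp add: matrix_vector_mult_def obs_def hid_def sum_distrib_left distrib_left mult.assoc)
    finally show ?thesis
      using ratio[where f = "\<lambda>k. r k * x k $ Inl i"] by (simp add: obs_def)
  qed
  have "block_row (mat 1) (matrix_inv R ** S) *v w = obs w + (matrix_inv R ** S) *v hid w"
    by (simp add: vec_eq_iff matrix_vector_mult_def sum_split block_row_def obs_def hid_def mat_def
        if_distrib[where f = "\<lambda>u. u * _"] cong: if_cong)
  also have "\<dots> = matrix_inv R *v (R *v obs w + S *v hid w)"
    by (simp add: matrix_vector_right_distrib matrix_vector_mul_assoc matrix_inv_inverse[OF inv])
  finally show ?thesis
    unfolding b_LS_def using tendsto_matrix_inv_mult_vec[OF A_lim b_lim inv] by simp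
qed

text \<open>Conditioning on an event of positive measure is a density with the constant value 1 /
  \<open>measure P A\<close> on it. This converts the moments given an action into moments under the
  unconditional law, to which the strong law applies.\<close>

lemma
  fixes g :: "'a \<Rightarrow> real"
  assumes P: "finite_measure P" and A[measurable]: "A \<in> sets P" and pos: "measure P A > 0"
    and g[measurable]: "g \<in> borel_measurable P"
  shows integrable_uniform_measure_iff:
      "integrable (uniform_measure P A) g \<longleftrightarrow> integrable P (\<lambda>x. indicator A x * g x)"
    and integral_uniform_measure:
      "(\<integral>x. g x \<partial>uniform_measure P A) = (\<integral>x. indicator A x * g x \<partial>P) / measure P A"
proof -
  interpret finite_measure P by fact
  have eq: "uniform_measure P A = density P (\<lambda>x. ennreal (indicator A x / measure P A))"
    unfolding uniform_measure_def
    by (intro arg_cong[where f = "density P"] ext)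
       (use pos in \<open>auto simp: emeasure_eq_measure divide_ennreal[of 1, simplified] split: split_indicator\<close>)
  have eq2: "(\<lambda>x. (indicator A x / measure P A) *\<^sub>R g x) =
      (\<lambda>x. 1 / measure P A * (indicator A x * g x))"
    by (simp add: fun_eq_iff)
  show "integrable (uniform_measure P A) g \<longleftrightarrow> integrable P (\<lambda>x. indicator A x * g x)"
  proof -
    have "integrable (uniform_measure P A) g \<longleftrightarrow> integrable P (\<lambda>x. 1 / measure P A * (indicator A x * g x))"
      unfolding eq eq2[symmetric] by (rule integrable_density) auto
    then show ?thesis using pos by (simp only: integrable_mult_left_iff) simp
  qed
  show "(\<integral>x. g x \<partial>uniform_measure P A) = (\<integral>x. indicator A x * g x \<partial>P) / measure P A"
    unfolding eq by (subst integral_density) (auto simp: eq2)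
qed

lemma (in prob_space) indep_var_of_indep_vars:
  assumes "indep_vars M' X I" and "i \<in> I" "j \<in> I" "i \<noteq> j"
  shows "indep_var (M' i) (X i) (M' j) (X j)"
proof -
  have "indep_var (M' i) ((\<lambda>g. g i) \<circ> (\<lambda>\<omega>. \<lambda>k\<in>{i}. X k \<omega>)) (M' j) ((\<lambda>g. g j) \<circ> (\<lambda>\<omega>. \<lambda>k\<in>{j}. X k \<omega>))"
    by (rule indep_var_compose[OF indep_var_restrict[OF assms(1)]])
       (use assms in \<open>auto intro: measurable_component_singleton\<close>)
  then show ?thesis by (simp add: comp_def)
qed

section \<open>Almost sure limits along the sample path\<close>

theorem proposition1:
  fixes M :: "'w measure"
    and Px :: "(real ^ ('l::finite + 'h::finite)) measure"
    and K :: nat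
    and \<pi> :: "real ^ ('l + 'h) \<Rightarrow> nat pmf"
    and w :: "nat \<Rightarrow> real ^ ('l + 'h)"
    and \<sigma> :: real
    and x :: "nat \<Rightarrow> 'w \<Rightarrow> real ^ ('l + 'h)"
    and act :: "nat \<Rightarrow> 'w \<Rightarrow> nat"
    and \<eta> r :: "nat \<Rightarrow> 'w \<Rightarrow> real"
    and P :: "((real ^ ('l + 'h)) \<times> nat) measure"
  assumes "prob_space M"
    and "prob_space Px" and "sets Px = sets borel"
    and "\<And>v. set_pmf (\<pi> v) \<subseteq> {1..K}"
    and "\<And>a. (\<lambda>v. pmf (\<pi> v) a) \<in> borel_measurable borel"
    and "P = behavior_law Px \<pi> K"
    and "prob_space.indep_vars M (\<lambda>_. borel \<Otimes>\<^sub>M count_space {1..K})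
           (\<lambda>i \<omega>. (x i \<omega>, act i \<omega>)) {1..}"
    and "\<And>i. i \<ge> 1 \<Longrightarrow>
           distr M (borel \<Otimes>\<^sub>M count_space {1..K}) (\<lambda>\<omega>. (x i \<omega>, act i \<omega>)) = P"
    and "\<And>i. i \<ge> 1 \<Longrightarrow> \<eta> i \<in> borel_measurable M"
    and "\<And>i. i \<ge> 1 \<Longrightarrow> cond_subgaussian M (history M K x act \<eta> i) \<sigma> (\<eta> i)"
    and "\<And>i \<omega>. i \<ge> 1 \<Longrightarrow> \<omega> \<in> space M \<Longrightarrow> r i \<omega> = x i \<omega> \<bullet> w (act i \<omega>) + \<eta> i \<omega>"
    and "\<And>a. a \<in> {1..K} \<Longrightarrow> action_prob P a > 0"
    and "\<And>a. a \<in> {1..K} \<Longrightarrow>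
           integrable (given_action P a) (\<lambda>z. outer (obs (fst z)) (obs (fst z)))"
    and "\<And>a. a \<in> {1..K} \<Longrightarrow>
           integrable (given_action P a) (\<lambda>z. outer (obs (fst z)) (hid (fst z)))"
    and "\<And>a. a \<in> {1..K} \<Longrightarrow> invertible (R11 P a)"
  shows "AE \<omega> in M. \<forall>a\<in>{1..K}.
    (\<lambda>N. b_LS (\<lambda>i. obs (x i \<omega>)) (\<lambda>i. act i \<omega>) (\<lambda>i. r i \<omega>) N a)
      \<longlonglongrightarrow> block_row (mat 1) (matrix_inv (R11 P a) ** R12 P a) *v w a"
proof -
  note One_nat_def [simp del]
  interpret prob_space M by fact
  let ?S = "borel \<Otimes>\<^sub>M count_space {1..K} :: ((real ^ ('l + 'h)) \<times> nat) measure"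
  define Z where "Z i \<omega> = (x i \<omega>, act i \<omega>)" for i \<omega>
  have indep: "indep_vars (\<lambda>_. ?S) Z {1..}"
    using assms(7) by (simp add: Z_def[abs_def])
  have Z: "Z i \<in> measurable M ?S" if "i \<ge> 1" for i
    using indep that unfolding indep_vars_def2 by auto
  have dZ: "distr M ?S (Z i) = P" if "i \<ge> 1" for i
    using assms(8)[OF that] by (simp add: Z_def[abs_def])
  have sets_P[measurable_cong]: "sets P = sets ?S" using dZ[of 1] by auto
  interpret P: prob_space P
    using prob_space_distr[OF Z[of 1]] dZ[of 1] by simp
  have int_Z: "integrable M (\<lambda>\<omega>. f (Z i \<omega>)) \<longleftrightarrow> integrable P f"
    and E_Z: "expectation (\<lambda>\<omega>. f (Z i \<omega>)) = integral\<^sup>L P f"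
    if "f \<in> borel_measurable ?S" "i \<ge> 1" for f :: "_ \<Rightarrow> real" and i
    using integrable_distr_eq[OF Z[OF that(2)] that(1)] integral_distr[OF Z[OF that(2)] that(1)]
    by (simp_all add: dZ[OF that(2)])
  \<comment> \<open>Independence and equality in law pass from the context-action pairs to any
    measurable function of them, so one statement serves the action counts and all regressor
    moments.\<close>
  have slln: "AE \<omega> in M. (\<lambda>n. (\<Sum>i<n. f (Z (Suc i) \<omega>)) / real n) \<longlonglongrightarrow> integral\<^sup>L P f"
    if f[measurable]: "f \<in> borel_measurable ?S" and int: "integrable P f" for f :: "_ \<Rightarrow> real"
  proof -
    have "AE \<omega> in M. (\<lambda>n. (\<Sum>i<n. f (Z (Suc i) \<omega>)) / real n) \<longlonglongrightarrow> expectation (\<lambda>\<omega>. f (Z (Suc 0) \<omega>))"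
    proof (rule strong_law_of_large_numbers)
      show "indep_var borel (\<lambda>\<omega>. f (Z (Suc i) \<omega>)) borel (\<lambda>\<omega>. f (Z (Suc j) \<omega>))" if "i \<noteq> j" for i j
        using indep_var_compose[OF indep_var_of_indep_vars[OF indep, of "Suc i" "Suc j"] f f] that
        by (simp add: comp_def)
      show "distr M borel (\<lambda>\<omega>. f (Z (Suc i) \<omega>)) = distr M borel (\<lambda>\<omega>. f (Z (Suc 0) \<omega>))" for i
        using distr_distr[OF f Z[of "Suc i"]] distr_distr[OF f Z[of "Suc 0"]]
        by (simp add: dZ comp_def)
      show "integrable M (\<lambda>\<omega>. f (Z (Suc 0) \<omega>))" using int by (simp add: int_Z)
    qed
    then show ?thesis by (simp add: E_Z)
  qed
  have main: "AE \<omega> in M. (\<lambda>N. b_LS (\<lambda>i. obs (x i \<omega>)) (\<lambda>i. act i \<omega>) (\<lambda>i. r i \<omega>) N a)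
      \<longlonglongrightarrow> block_row (mat 1) (matrix_inv (R11 P a) ** R12 P a) *v w a" if a: "a \<in> {1..K}" for a
  proof -
    define p where "p = action_prob P a"
    have p: "p > 0" unfolding p_def by (rule assms(12)[OF a])
    define A where "A = {z \<in> space P. snd z = a}"
    have A[measurable]: "A \<in> sets P"
    proof -
      have "snd \<in> measurable P (count_space {1..K})" by measurable
      from measurable_sets[OF this, of "{a}"] have "snd -` {a} \<inter> space P \<in> sets P" using a by simp
      also have "snd -` {a} \<inter> space P = A" by (auto simp: A_def)
      finally show ?thesis .
    qed
    have measure_A: "measure P A = p" by (simp add: p_def action_prob_def A_def)
    define I :: "_ \<Rightarrow> real" where "I z = indicator {a} (snd z)" for z :: "(real ^ ('l + 'h)) \<times> nat"
    have I[measurable]: "I \<in> borel_measurable ?S"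
      unfolding I_def[abs_def] by (rule measurable_compose[OF measurable_snd]) simp
    define c where "c k z = fst z $ k" for k :: "'l + 'h" and z :: "(real ^ ('l + 'h)) \<times> nat"
    have c[measurable]: "c k \<in> borel_measurable ?S" for k
      unfolding c_def[abs_def]
      by (rule measurable_compose[OF measurable_fst]) (intro borel_measurable_continuous_onI continuous_intros)
    have given: "given_action P a = uniform_measure P A" by (simp add: given_action_def A_def)
    have given_int: "integrable P (\<lambda>z. I z * g z)"
      and given_integral: "(\<integral>z. I z * g z \<partial>P) = p * (\<integral>z. g z \<partial>given_action P a)"
      if g[measurable]: "g \<in> borel_measurable ?S" and int: "integrable (given_action P a) g" for g :: "_ \<Rightarrow> real"
    proof -
      \<comment> \<open>The two indicators are compared only on the space of \<open>P\<close>, since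
        \<open>A\<close> contains no points outside it.\<close>
      have IA: "indicator A z = I z" if "z \<in> space P" for z using that by (auto simp: A_def I_def split: split_indicator)
      have gP: "g \<in> borel_measurable P" by measurable
      show "integrable P (\<lambda>z. I z * g z)"
        using integrable_uniform_measure_iff[OF P.finite_measure_axioms A _ gP] int p
        by (simp add: measure_A given IA cong: Bochner_Integration.integrable_cong)
      show "(\<integral>z. I z * g z \<partial>P) = p * (\<integral>z. g z \<partial>given_action P a)"
        using integral_uniform_measure[OF P.finite_measure_axioms A _ gP] p
        by (simp add: measure_A given IA cong: Bochner_Integration.integral_cong)
    qed
    \<comment> \<open>Reading off an entry is bounded linear and thus commutes with the
      matrix-valued integrals defining \<open>R11\<close> and \<open>R12\<close>.\<close>
    have lin: "bounded_linear (\<lambda>B :: real ^ 'n ^ 'm. B $ i $ j)" for i :: "'m::finite" and j :: "'n::finite"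
      by (rule bounded_linear_compose[OF bounded_linear_vec_nth bounded_linear_vec_nth])
    have int11: "integrable (given_action P a) (\<lambda>z. c (Inl i) z * c (Inl j) z)"
      and E11: "(\<integral>z. c (Inl i) z * c (Inl j) z \<partial>given_action P a) = R11 P a $ i $ j" for i j
      using integrable_bounded_linear[OF lin assms(13)[OF a], of i j]
        integral_bounded_linear[OF lin assms(13)[OF a], of i j]
      by (simp_all add: R11_def outer_def obs_def c_def)
    have int12: "integrable (given_action P a) (\<lambda>z. c (Inl i) z * c (Inr j) z)"
      and E12: "(\<integral>z. c (Inl i) z * c (Inr j) z \<partial>given_action P a) = R12 P a $ i $ j" for i j
      using integrable_bounded_linear[OF lin assms(14)[OF a], of i j]
        integral_bounded_linear[OF lin assms(14)[OF a], of i j]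
      by (simp_all add: R12_def outer_def obs_def hid_def c_def)
    have lim0: "AE \<omega> in M. (\<lambda>n. (\<Sum>i<n. I (Z (Suc i) \<omega>)) / real n) \<longlonglongrightarrow> p"
    proof -
      have "(\<integral>z. I z \<partial>P) = (\<integral>z. indicator A z \<partial>P)"
        by (rule Bochner_Integration.integral_cong) (auto simp: I_def A_def split: split_indicator)
      moreover have "integrable P I"
        by (rule P.integrable_const_bound[of _ 1]) (auto simp: I_def split: split_indicator)
      ultimately show ?thesis using slln[OF I] by (simp add: measure_A)
    qed
    \<comment> \<open>The index l runs over observed and hidden coordinates alike, so both moment
      matrices are covered at once.\<close>
    have lim_c: "AE \<omega> in M. (\<lambda>n. (\<Sum>k<n. I (Z (Suc k) \<omega>) * (c (Inl i) (Z (Suc k) \<omega>) * c l (Z (Suc k) \<omega>))) / real n) \<longlonglongrightarrow>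
        p * (\<integral>z. c (Inl i) z * c l z \<partial>given_action P a)" for i l
    proof -
      have int: "integrable (given_action P a) (\<lambda>z. c (Inl i) z * c l z)"
        using int11 int12 by (cases l) auto
      show ?thesis
        using slln[of "\<lambda>z. I z * (c (Inl i) z * c l z)"] given_int[OF _ int] given_integral[OF _ int] by simp
    qed
    have lim_\<eta>: "AE \<omega> in M. (\<lambda>n. (\<Sum>k<n. I (Z (Suc k) \<omega>) * c (Inl i) (Z (Suc k) \<omega>) * \<eta> (Suc k) \<omega>) / real n) \<longlonglongrightarrow> 0" for i
    proof -
      \<comment> \<open>An indicator equals its square, so the squared noise weight is the integrand
        of a diagonal entry of \<open>R11\<close> times the indicator; its integrability is thereby
        already known.\<close>
      have sq: "(\<lambda>z. (I z * c (Inl i) z)\<^sup>2) = (\<lambda>z. I z * (c (Inl i) z * c (Inl i) z))"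
        by (auto simp: I_def power2_eq_square fun_eq_iff split: split_indicator)
      have int: "integrable P (\<lambda>z. (I z * c (Inl i) z)\<^sup>2)"
        unfolding sq by (rule given_int[OF _ int11]) measurable
      show ?thesis
        using AE_noise_average_tendsto_0[of x act K \<eta> \<sigma> "\<lambda>z. I z * c (Inl i) z" "\<integral>z. (I z * c (Inl i) z)\<^sup>2 \<partial>P"]
          Z[unfolded Z_def[abs_def]] assms(9,10) int int_Z[of "\<lambda>z. (I z * c (Inl i) z)\<^sup>2"] E_Z[of "\<lambda>z. (I z * c (Inl i) z)\<^sup>2"]
        by (simp add: Z_def[abs_def])
    qed
    \<comment> \<open>The coordinates are finitely many, which gives one null set outside which all
      limits hold together.\<close>
    have "AE \<omega> in M. \<forall>i l. (\<lambda>n. (\<Sum>k<n. I (Z (Suc k) \<omega>) * (c (Inl i) (Z (Suc k) \<omega>) * c l (Z (Suc k) \<omega>))) / real n) \<longlonglongrightarrow>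
        p * (\<integral>z. c (Inl i) z * c l z \<partial>given_action P a)"
      and "AE \<omega> in M. \<forall>i. (\<lambda>n. (\<Sum>k<n. I (Z (Suc k) \<omega>) * c (Inl i) (Z (Suc k) \<omega>) * \<eta> (Suc k) \<omega>) / real n) \<longlonglongrightarrow> 0"
      using lim_c lim_\<eta> by (simp_all add: AE_all_countable)
    then show ?thesis using lim0 AE_space
    proof eventually_elim
      case (elim \<omega>)
      show ?case
      proof (rule b_LS_tendsto)
        show "r i \<omega> = x i \<omega> \<bullet> w a + \<eta> i \<omega>" if "i \<ge> 1" "act i \<omega> = a" for i
          using assms(11)[OF that(1) elim(4)] that(2) by simp
        show "(\<lambda>N. (\<Sum>k<N. indicator {a} (act (Suc k) \<omega>)) / real N) \<longlonglongrightarrow> p"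
          using elim(3) by (simp add: I_def Z_def)
        show "(\<lambda>N. (\<Sum>k<N. indicator {a} (act (Suc k) \<omega>) *
            (x (Suc k) \<omega> $ Inl i * x (Suc k) \<omega> $ Inl j)) / real N) \<longlonglongrightarrow> p * R11 P a $ i $ j" for i j
          using elim(1)[rule_format, of i "Inl j"] unfolding E11 by (simp add: I_def Z_def c_def)
        show "(\<lambda>N. (\<Sum>k<N. indicator {a} (act (Suc k) \<omega>) *
            (x (Suc k) \<omega> $ Inl i * x (Suc k) \<omega> $ Inr j)) / real N) \<longlonglongrightarrow> p * R12 P a $ i $ j" for i j
          using elim(1)[rule_format, of i "Inr j"] unfolding E12 by (simp add: I_def Z_def c_def)
        show "(\<lambda>N. (\<Sum>k<N. indicator {a} (act (Suc k) \<omega>) * x (Suc k) \<omega> $ Inl i * \<eta> (Suc k) \<omega>) / real N)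
            \<longlonglongrightarrow> 0" for i
          using elim(2)[rule_format, of i] by (simp add: I_def Z_def c_def)
      qed (use p assms(15)[OF a] in auto)
    qed
  qed
  show ?thesis
    by (rule AE_finite_allI) (auto intro: main)
qed

end
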